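(* Set $$h_\star=\frac{2}{\sqrt{26}},\qquad \beta_\star=\frac49,\qquad \gamma_\star=-\frac1{h_\star}\log\frac49 .$$ There exist a potential $U\in C^\infty(\mathbb R)$ satisfying $1\le U''\le25$ and a constant $C>0$ such that the following holds for every $R\ge1$. Let $U_R(x)=R^2U(x/R)$ and $Q_R=Q_{h_\star,\gamma_\star}^{U_R}$. Then $U_R\in\mathcal U_{25}^1$, $Q_R$ has a unique invariant law $\pi_R$, and at least one of the two initial states $$z_R^{\mathrm{cyc}}=\Bigl(\tfrac{2592}{1225}R,\ \tfrac{360\sqrt{26}}{637}R\Bigr),\qquad z_R^0=(0,0)$$ in $\mathbb R^2$ (position, velocity), denoted by $z_R$, satisfies $$W_2(\delta_{z_R},\pi_R)\le CR,\qquad \|\delta_{z_R}Q_R^n-\pi_R\|_{\mathrm{TV}}\ge\frac38\quad\text{for all integers }0\le n\le\Bigl\lfloor\frac1{16}e^{R^2/8000}\Bigr\rfloor .$$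
   Context: OBABO chain. For a differentiable $U:\mathbb R^d\to\mathbb R$ and $h,\gamma>0$, put $r=e^{-\gamma h/2}$, $\beta=r^2=e^{-\gamma h}$, $\sigma=(1-\beta)^{1/2}$. One OBABO step maps $(x,v)\in\mathbb R^d\times\mathbb R^d$ to $(x^+,v^+)$ by $v^{(a)}=rv+\sigma\xi^{(1)}$, $v^{(b)}=v^{(a)}-\frac h2\nabla U(x)$, $x^+=x+hv^{(b)}$, $v^{(c)}=v^{(b)}-\frac h2\nabla U(x^+)$, $v^+=rv^{(c)}+\sigma\xi^{(2)}$, where $\xi^{(1)},\xi^{(2)}$ are independent $\mathcal N(0,\mathrm{Id}_d)$. Iterating with i.i.d. copies of $(\xi^{(1)},\xi^{(2)})$ defines a Markov chain with transition kernel $Q_{h,\gamma}^U$. $\mathcal U_{\kappa}^1=\{U\in C^\infty(\mathbb R): 1\le U''(x)\le\kappa\text{ for every }x\}$. $\|\nu-\widetilde\nu\|_{\mathrm{TV}}=\sup_A|\nu(A)-\widetilde\nu(A)|$; $W_2$ is the Euclidean $2$-Wasserstein distance; $\delta_z$ is the Dirac mass at $z$. *)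

theory Defs
  imports "HOL-Probability.Probability"
begin

section \<open>Smooth potentials\<close>

text \<open>
  Differentiability of every iterated derivative already forces each of them to be continuous.
\<close>
definition smooth :: "(real \<Rightarrow> real) \<Rightarrow> bool" where
  "smooth U \<longleftrightarrow> (\<forall>n x. ((deriv ^^ n) U) differentiable (at x))"

definition potential_class :: "real \<Rightarrow> (real \<Rightarrow> real) set" where
  "potential_class \<kappa> = {U. smooth U \<and> (\<forall>x. 1 \<le> deriv (deriv U) x \<and> deriv (deriv U) x \<le> \<kappa>)}"

text \<open>
  Only meaningful where \<open>U\<close> is differentiable; on the reals it is the usual derivative.
\<close>
definition grad :: "('a::euclidean_space \<Rightarrow> real) \<Rightarrow> 'a \<Rightarrow> 'a" where
  "grad U x = (THE D. GDERIV U x :> D)"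

section \<open>The OBABO chain\<close>

definition std_gaussian :: "'a::euclidean_space measure" where
  "std_gaussian = density lborel (\<lambda>x. ennreal (\<Prod>b\<in>Basis. std_normal_density (x \<bullet> b)))"

definition obabo_step ::
  "real \<Rightarrow> real \<Rightarrow> ('a::euclidean_space \<Rightarrow> real) \<Rightarrow> 'a \<times> 'a \<Rightarrow> 'a \<times> 'a \<Rightarrow> 'a \<times> 'a" where
  "obabo_step h \<gamma> U = (\<lambda>(x, v) (\<xi>1, \<xi>2).
     let r = exp (- \<gamma> * h / 2);
         \<beta> = r\<^sup>2;
         \<sigma> = sqrt (1 - \<beta>);
         va = r *\<^sub>R v + \<sigma> *\<^sub>R \<xi>1;
         vb = va - (h / 2) *\<^sub>R grad U x;
         x' = x + h *\<^sub>R vb;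
         vc = vb - (h / 2) *\<^sub>R grad U x';
         v' = r *\<^sub>R vc + \<sigma> *\<^sub>R \<xi>2
     in (x', v'))"

definition obabo_kernel ::
  "real \<Rightarrow> real \<Rightarrow> ('a::euclidean_space \<Rightarrow> real) \<Rightarrow> 'a \<times> 'a \<Rightarrow> ('a \<times> 'a) measure" where
  "obabo_kernel h \<gamma> U z = distr (std_gaussian \<Otimes>\<^sub>M std_gaussian) borel (obabo_step h \<gamma> U z)"

section \<open>Markov kernels and distances between laws\<close>

definition law_after :: "('b::topological_space \<Rightarrow> 'b measure) \<Rightarrow> nat \<Rightarrow> 'b measure \<Rightarrow> 'b measure" where
  "law_after Q n \<mu> = ((\<lambda>\<nu>. \<nu> \<bind> Q) ^^ n) \<mu>"

definition invariant_law :: "('b::topological_space \<Rightarrow> 'b measure) \<Rightarrow> 'b measure \<Rightarrow> bool" where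
  "invariant_law Q \<pi> \<longleftrightarrow> prob_space \<pi> \<and> sets \<pi> = sets borel \<and> \<pi> \<bind> Q = \<pi>"

definition dirac :: "'b::topological_space \<Rightarrow> 'b measure" where
  "dirac z = return borel z"

text \<open>For probability measures on the same \<open>\<sigma>\<close>-algebra.\<close>
definition tv_dist :: "'b measure \<Rightarrow> 'b measure \<Rightarrow> real" where
  "tv_dist \<mu> \<nu> = (SUP A\<in>sets \<mu>. \<bar>measure \<mu> A - measure \<nu> A\<bar>)"

definition couplings ::
  "'b::topological_space measure \<Rightarrow> 'b measure \<Rightarrow> ('b \<times> 'b) measure set" where
  "couplings \<mu> \<nu> = {\<Gamma>. prob_space \<Gamma> \<and> sets \<Gamma> = sets (borel \<Otimes>\<^sub>M borel)
                       \<and> distr \<Gamma> borel fst = \<mu> \<and> distr \<Gamma> borel snd = \<nu>}"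

definition ennreal_sqrt :: "ennreal \<Rightarrow> ennreal" where
  "ennreal_sqrt c = (if c = \<infinity> then \<infinity> else ennreal (sqrt (enn2real c)))"

text \<open>
  Valued in \<open>ennreal\<close>, so an upper bound by a real number includes finiteness. On a product of
  Euclidean spaces \<open>dist\<close> is the Euclidean distance.
\<close>
definition W2 :: "'b::metric_space measure \<Rightarrow> 'b measure \<Rightarrow> ennreal" where
  "W2 \<mu> \<nu> = ennreal_sqrt (INF \<Gamma>\<in>couplings \<mu> \<nu>. \<integral>\<^sup>+ (x, y). ennreal ((dist x y)\<^sup>2) \<partial>\<Gamma>)"

section \<open>Parameters\<close>

definition h_star :: real where
  "h_star = 2 / sqrt 26"

definition beta_star :: real where
  "beta_star = 4 / 9"

definition gamma_star :: real where
  "gamma_star = - (1 / h_star) * ln beta_star"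

definition scaled_potential :: "real \<Rightarrow> (real \<Rightarrow> real) \<Rightarrow> real \<Rightarrow> real" where
  "scaled_potential R U x = R\<^sup>2 * U (x / R)"

definition z_cyc :: "real \<Rightarrow> real \<times> real" where
  "z_cyc R = (2592 / 1225 * R, 360 * sqrt 26 / 637 * R)"

end

theory Submission
  imports Defs
begin

text \<open>
  Eliminating the velocity from the noiseless step leaves the heavy-ball recursion
  \<open>x\<^sub>n\<^sub>+\<^sub>1 = x\<^sub>n + \<beta> (x\<^sub>n - x\<^sub>n\<^sub>-\<^sub>1) - \<alpha> U'(x\<^sub>n)\<close> with \<open>\<beta> = 4/9\<close> and \<open>\<alpha> = (1 + \<beta>) h\<^sup>2 / 2 = 1/9\<close>.
  These are the parameters that are optimal for quadratic potentials with curvature in \<open>[1, 25]\<close>,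
  and Lessard, Recht and Packard found a strongly convex piecewise quadratic potential for which
  the recursion has an attracting cycle of period three, through \<open>2592/1225\<close>, \<open>792/1225\<close> and
  \<open>-2208/1225\<close>. Its curvature is \<open>25\<close> outside the interval \<open>[1, 2]\<close>. A potential whose curvature
  is \<open>25 - 12 (tanh (k (x - a)) - tanh (k (x - b)))\<close> with \<open>k\<close> large, \<open>a = 22/25\<close> and \<open>b = 47/25\<close>
  is smooth, and its gradient differs from \<open>25 x\<close> left of \<open>a\<close>, and from \<open>25 x - 24\<close> right of \<open>b\<close>,
  by a tiny amount only; this covers neighbourhoods of \<open>0\<close> and of all three points of the cycle
  (\<open>potential_exists\<close>).

  Where the curvature is \<open>25\<close> the recursion is linear with the double eigenvalue \<open>-2/3\<close>. In the
  coordinates \<open>x\<close> and \<open>lag\<close>, the latter being the expected next position plus \<open>2/3 x\<close> for the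
  potential \<open>25 x\<^sup>2 / 2\<close>, the step is a Jordan block plus the contribution of the bounded function
  \<open>G(x) = U'(x) - 25 x\<close> plus noise (\<open>obabo_step_coordinates\<close>). Everything else is read off
  from this form.

  Near \<open>0\<close> and near the cycle the step contracts towards the fixed point and the cycle. Small boxes,
  of size proportional to \<open>R\<close> after rescaling, are therefore mapped into boxes as long as both
  Gaussian variables are at most \<open>R/30\<close> in absolute value (\<open>rest_region_stable\<close>,
  \<open>cycle_region_stable\<close>), and each of the two disjoint regions is left with probability at most
  \<open>2 \<surd>2 exp (-R\<^sup>2/3600)\<close> per step. One of the regions has mass at most \<open>1/2\<close> under
  the invariant law; the chain started in that region has mass at least \<open>7/8\<close> there for
  all times considered, and the total variation distance is at least \<open>7/8 - 1/2 = 3/8\<close>.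

  Globally the step is a stable linear map plus a perturbation of order \<open>R\<close> and Gaussian noise.
  So a quadratic function satisfies a drift condition with constant of order \<open>R\<^sup>2\<close>, and the
  transition density of one step, whose first noise spreads the position and whose second noise
  spreads the velocity, is bounded below on compact sets. Harris's theorem
  (\<open>harris_invariant_law\<close>) gives existence and uniqueness of the invariant law and a second
  moment of order \<open>R\<^sup>2\<close>, hence the bound on the Wasserstein distance.
\<close>

section \<open>Smooth functions and rescaling\<close>

lemma smoothI:
  assumes "\<And>x. (U has_real_derivative F x) (at x)" and "smooth F"
  shows "smooth U"
  unfolding smooth_def
proof (intro allI)
  fix n x
  have dU: "deriv U = F"
    using assms(1) by (auto intro!: ext DERIV_imp_deriv)
  show "(deriv ^^ n) U differentiable at x"
  proof (cases n)
    case 0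
    then show ?thesis
      using assms(1)[of x] by (auto simp: real_differentiable_def)
  next
    case (Suc m)
    then have "(deriv ^^ n) U = (deriv ^^ m) F"
      by (simp only: funpow_Suc_right o_apply dU)
    then show ?thesis
      using assms(2) by (simp add: smooth_def)
  qed
qed

text \<open>
  A class of functions closed under differentiation consists of smooth functions; this avoids closed
  forms for higher derivatives.
\<close>
lemma smooth_deriv_closed:
  assumes "P f" and "\<And>f. P f \<Longrightarrow> \<exists>f'. P f' \<and> (\<forall>x. (f has_real_derivative f' x) (at x))"
  shows "smooth f"
  unfolding smooth_def
proof (intro allI)
  fix n x
  have "P ((deriv ^^ n) f)"
  proof (induction n)
    case (Suc n)
    then obtain f' where f': "P f'" "\<forall>x. ((deriv ^^ n) f has_real_derivative f' x) (at x)"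
      using assms(2) by blast
    then have "(deriv ^^ Suc n) f = f'"
      by (auto intro!: DERIV_imp_deriv)
    with f'(1) show ?case by simp
  qed (use assms(1) in simp)
  then show "(deriv ^^ n) f differentiable at x"
    using assms(2) by (meson real_differentiable_def)
qed

text \<open>
  Since \<open>tanh' = 1 - tanh\<^sup>2\<close>, polynomials in \<open>tanh\<close> are closed under differentiation.
\<close>
lemma smooth_poly_tanh:
  fixes k a b :: real
  shows "smooth (\<lambda>x. poly p (tanh (k * (x - a))) + poly q (tanh (k * (x - b))))"
proof (rule smooth_deriv_closed[where
      P = "\<lambda>f. \<exists>p q. f = (\<lambda>x. poly p (tanh (k * (x - a))) + poly q (tanh (k * (x - b))))"])
  fix f assume "\<exists>p q. f = (\<lambda>x. poly p (tanh (k * (x - a))) + poly q (tanh (k * (x - b))))"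
  then obtain p q where f: "f = (\<lambda>x. poly p (tanh (k * (x - a))) + poly q (tanh (k * (x - b))))"
    by blast
  define D where "D p = smult k (pderiv p * [:1, 0, -1:])" for p :: "real poly"
  have D: "((\<lambda>x. poly p (tanh (k * (x - a)))) has_real_derivative poly (D p) (tanh (k * (x - a)))) (at x)"
    for p a x
    unfolding D_def
    by (rule derivative_eq_intros DERIV_chain2[OF poly_DERIV] refl | simp)+
       (simp add: algebra_simps power2_eq_square)
  have "\<forall>x. (f has_real_derivative
      poly (D p) (tanh (k * (x - a))) + poly (D q) (tanh (k * (x - b)))) (at x)"
    unfolding f by (intro allI DERIV_add D)
  then show "\<exists>f'. (\<exists>p q. f' = (\<lambda>x. poly p (tanh (k * (x - a))) + poly q (tanh (k * (x - b))))) \<and>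
      (\<forall>x. (f has_real_derivative f' x) (at x))"
    by (intro exI[of _ "\<lambda>x. poly (D p) (tanh (k * (x - a))) + poly (D q) (tanh (k * (x - b)))"]) auto
qed blast

lemma smooth_differentiable:
  assumes "smooth U"
  shows "((deriv ^^ n) U has_real_derivative (deriv ^^ Suc n) U x) (at x)"
  using assms by (simp add: smooth_def DERIV_deriv_iff_real_differentiable)

lemma smooth_scaled_potential:
  assumes "smooth U" "R \<noteq> 0"
  shows "smooth (scaled_potential R U)"
proof (rule smooth_deriv_closed[where P = "\<lambda>f. \<exists>n c. f = (\<lambda>x. c * (deriv ^^ n) U (x / R))"])
  show "\<exists>n c. scaled_potential R U = (\<lambda>x. c * (deriv ^^ n) U (x / R))"
    by (rule exI[of _ 0], rule exI[of _ "R\<^sup>2"]) (simp add: scaled_potential_def fun_eq_iff)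
  fix f assume "\<exists>n c. f = (\<lambda>x. c * (deriv ^^ n) U (x / R))"
  then obtain n c where f: "f = (\<lambda>x. c * (deriv ^^ n) U (x / R))" by blast
  have "(f has_real_derivative c / R * (deriv ^^ Suc n) U (x / R)) (at x)" for x
  proof -
    have "((\<lambda>x. (deriv ^^ n) U (x / R)) has_real_derivative (deriv ^^ Suc n) U (x / R) * (1 / R)) (at x)"
      by (rule DERIV_chain2[OF smooth_differentiable[OF assms(1)]])
         (auto intro!: derivative_eq_intros simp: assms(2))
    from DERIV_cmult[OF this, of c] show ?thesis by (simp add: f)
  qed
  then show "\<exists>f'. (\<exists>n c. f' = (\<lambda>x. c * (deriv ^^ n) U (x / R))) \<and> (\<forall>x. (f has_real_derivative f' x) (at x))"
    by (intro exI[of _ "\<lambda>x. c / R * (deriv ^^ Suc n) U (x / R)"] conjI) blast+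
qed

lemma scaled_potential_deriv:
  assumes "\<And>x. (U has_real_derivative F x) (at x)" "R \<noteq> 0"
  shows "(scaled_potential R U has_real_derivative R * F (x / R)) (at x)"
proof -
  have "((\<lambda>x. U (x / R)) has_real_derivative F (x / R) * (1 / R)) (at x)"
    by (rule DERIV_chain2[OF assms(1)]) (auto intro!: derivative_eq_intros simp: assms(2))
  from DERIV_cmult[OF this, of "R\<^sup>2"] show ?thesis
    using assms(2) by (simp add: scaled_potential_def[abs_def] power2_eq_square)
qed

lemma scaled_potential_deriv2:
  assumes "smooth U" "R \<noteq> 0"
  shows "deriv (deriv (scaled_potential R U)) x = deriv (deriv U) (x / R)"
proof -
  have "deriv (scaled_potential R U) = (\<lambda>x. R * deriv U (x / R))"
    using scaled_potential_deriv[OF smooth_differentiable[OF assms(1), of 0, simplified] assms(2)]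
    by (auto intro!: DERIV_imp_deriv)
  moreover have "((\<lambda>x. R * deriv U (x / R)) has_real_derivative deriv (deriv U) (x / R)) (at x)"
  proof -
    have "((\<lambda>x. deriv U (x / R)) has_real_derivative deriv (deriv U) (x / R) * (1 / R)) (at x)"
      by (rule DERIV_chain2[OF smooth_differentiable[OF assms(1), of 1, simplified]])
         (auto intro!: derivative_eq_intros simp: assms(2))
    from DERIV_cmult[OF this, of R] show ?thesis
      using assms(2) by simp
  qed
  ultimately show ?thesis by (simp add: DERIV_imp_deriv)
qed

section \<open>A potential with a heavy-ball cycle\<close>

lemma ln_cosh_bounds:
  fixes t :: real
  shows "ln (cosh t) \<le> \<bar>t\<bar>" and "\<bar>t\<bar> - ln 2 \<le> ln (cosh t)"
proof -
  have "cosh t \<le> exp \<bar>t\<bar>"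
    unfolding cosh_def by (cases "t \<ge> 0") (auto simp: field_simps)
  then have "ln (cosh t) \<le> ln (exp \<bar>t\<bar>)"
    by (subst ln_le_cancel_iff) auto
  then show "ln (cosh t) \<le> \<bar>t\<bar>" by simp
  have "exp \<bar>t\<bar> / 2 \<le> cosh t"
    unfolding cosh_def by (cases "t \<ge> 0") auto
  then have "ln (exp \<bar>t\<bar> / 2) \<le> ln (cosh t)"
    by (subst ln_le_cancel_iff) auto
  then show "\<bar>t\<bar> - ln 2 \<le> ln (cosh t)"
    by (simp add: ln_div)
qed

text \<open>
  The term \<open>(12 / k) (ln (cosh (k (x - a))) - ln (cosh (k (x - b))))\<close> in the gradient is within
  \<open>(12 / k) ln 2\<close> of \<open>12 (\<bar>x - a\<bar> - \<bar>x - b\<bar>)\<close>, which equals \<open>-12\<close> left of \<open>a\<close> and \<open>12\<close> right of \<open>b\<close> because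
  \<open>b - a = 1\<close>. The constants \<open>a\<close> and \<open>b\<close> are roughly centred between the two positive points
  \<open>0.647\<close> and \<open>2.116\<close> of the cycle, leaving more than \<open>9/50\<close> on either side.
\<close>
lemma potential_exists:
  obtains U F :: "real \<Rightarrow> real" where
    "\<And>x. (U has_real_derivative F x) (at x)" "smooth U"
    "\<And>x. 1 \<le> deriv (deriv U) x" "\<And>x. deriv (deriv U) x \<le> 25"
    "\<And>x. \<bar>F x - 25 * x\<bar> \<le> 25"
    "\<And>x. x \<le> 22/25 \<Longrightarrow> \<bar>F x - 25 * x\<bar> \<le> 3/250"
    "\<And>x. x \<ge> 47/25 \<Longrightarrow> \<bar>F x - (25 * x - 24)\<bar> \<le> 3/250"
proof -
  define k a b :: real where "k = 1000" and "a = 22/25" and "b = 47/25"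
  define L where "L c x = ln (cosh (k * (x - c)))" for c x
  define F where "F x = 25 * x - 12 - 12 / k * (L a x - L b x)" for x
  define F' where "F' x = 25 - 12 * (tanh (k * (x - a)) - tanh (k * (x - b)))" for x
  have dF: "(F has_real_derivative F' x) (at x)" for x
    unfolding F_def F'_def L_def
    by (rule derivative_eq_intros refl | simp)+
       (simp add: tanh_def k_def field_simps)
  have "\<exists>U. \<forall>x. -\<infinity> < ereal x \<longrightarrow> ereal x < \<infinity> \<longrightarrow> (U has_vector_derivative F x) (at x)"
    by (rule einterval_antiderivative) (auto intro: DERIV_isCont[OF dF])
  then obtain U where dU: "\<And>x. (U has_real_derivative F x) (at x)"
    by (auto simp: has_real_derivative_iff_has_vector_derivative)
  have F'_poly: "F' = (\<lambda>x. poly [:25, -12:] (tanh (k * (x - a))) + poly [:0, 12:] (tanh (k * (x - b))))"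
    by (auto simp: F'_def)
  have "smooth F'"
    unfolding F'_poly by (rule smooth_poly_tanh)
  then have smooth: "smooth U"
    by (intro smoothI[OF dU] smoothI[OF dF])
  have dd: "deriv (deriv U) = F'"
  proof -
    have "deriv U = F" using dU by (auto intro!: ext DERIV_imp_deriv)
    then show ?thesis using dF by (auto intro!: ext DERIV_imp_deriv)
  qed
  have "tanh (k * (x - b)) \<le> tanh (k * (x - a))" for x
    by (simp add: k_def a_def b_def)
  then have ub: "F' x \<le> 25" for x
    by (simp add: F'_def)
  have lb: "1 \<le> F' x" for x
  proof -
    have "1 \<le> 25 - 12 * (s - t)" if "s < 1" "- 1 < t" for s t :: real
      using that by simp
    from this[OF tanh_real_lt_1 tanh_real_gt_neg1] show ?thesis
      unfolding F'_def .
  qed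
  have ln2: "ln 2 \<le> (1::real)"
    using ln_le_minus_one[of "2::real"] by simp
  have F_eq: "F x = 25 * x - 12 - 3 / 250 * L (22/25) x + 3 / 250 * L (47/25) x" for x
    by (simp add: F_def k_def a_def b_def algebra_simps)
  note L_bounds = ln_cosh_bounds[of "k * (x - a)" for x, folded L_def]
    ln_cosh_bounds[of "k * (x - b)" for x, folded L_def]
  show ?thesis
  proof (rule that[of U F])
    show "\<bar>F x - 25 * x\<bar> \<le> 25" for x
      using L_bounds[of x] ln2 unfolding F_eq
      by (auto simp: k_def a_def b_def abs_if split: if_splits)
    show "\<bar>F x - 25 * x\<bar> \<le> 3/250" if "x \<le> 22/25" for x
      using L_bounds[of x] ln2 that unfolding F_eq
      by (auto simp: k_def a_def b_def abs_if split: if_splits)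
    show "\<bar>F x - (25 * x - 24)\<bar> \<le> 3/250" if "x \<ge> 47/25" for x
      using L_bounds[of x] ln2 that unfolding F_eq
      by (auto simp: k_def a_def b_def abs_if split: if_splits)
  qed (use dU smooth dd ub lb in auto)
qed

section \<open>Markov chains that charge a fixed measure on a small set\<close>

text \<open>
  The additive set identity is all that is known about the residual kernel below, and integrals
  against it are needed as well.
\<close>
lemma nn_integral_split_measure:
  assumes [measurable]: "f \<in> borel_measurable M"
    and sets: "sets M1 = sets M" "sets M2 = sets M"
    and eq: "\<And>A. A \<in> sets M \<Longrightarrow> emeasure M A = emeasure M1 A + c * emeasure M2 A"
  shows "(\<integral>\<^sup>+x. f x \<partial>M) = (\<integral>\<^sup>+x. f x \<partial>M1) + c * (\<integral>\<^sup>+x. f x \<partial>M2)"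
  using assms(1)
proof (induction rule: borel_measurable_induct)
  case (cong f g)
  have "(\<integral>\<^sup>+x. f x \<partial>N) = (\<integral>\<^sup>+x. g x \<partial>N)" if "sets N = sets M" for N
    using cong(3) sets_eq_imp_space_eq[OF that] by (intro nn_integral_cong) auto
  then show ?case using cong sets by simp
next
  case (set A)
  then show ?case using eq[of A] sets by simp
next
  case (mult u a)
  have "u \<in> borel_measurable N" if "sets N = sets M" for N
    using mult(2) that by (simp cong: measurable_cong_sets)
  then show ?case using mult sets
    by (simp add: nn_integral_cmult distrib_left mult_ac)
next
  case (add u v)
  have "u \<in> borel_measurable N" "v \<in> borel_measurable N" if "sets N = sets M" for N
    using add that by (simp_all cong: measurable_cong_sets)
  then show ?case using add sets
    by (simp add: nn_integral_add distrib_left ac_simps)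
next
  case (seq F)
  have mf: "F i \<in> borel_measurable N" if "sets N = sets M" for N i
    using seq(1)[of i] that by (simp cong: measurable_cong_sets)
  have lim: "(\<integral>\<^sup>+x. (SUP i. F i) x \<partial>N) = (SUP i. \<integral>\<^sup>+x. F i x \<partial>N)" if "sets N = sets M" for N
    using nn_integral_monotone_convergence_SUP[OF seq(3) mf[OF that]] by (simp add: image_comp)
  have inc: "incseq (\<lambda>i. \<integral>\<^sup>+x. F i x \<partial>N)" for N
    using seq(3) by (auto simp: incseq_def le_fun_def intro!: nn_integral_mono)
  have "(SUP i. \<integral>\<^sup>+x. F i x \<partial>M) = (SUP i. (\<integral>\<^sup>+x. F i x \<partial>M1) + c * (\<integral>\<^sup>+x. F i x \<partial>M2))"
    using seq by simp
  also have "\<dots> = (SUP i. \<integral>\<^sup>+x. F i x \<partial>M1) + (SUP i. c * (\<integral>\<^sup>+x. F i x \<partial>M2))"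
    using inc by (intro ennreal_SUP_add) (auto simp: incseq_def intro!: mult_left_mono)
  also have "(SUP i. c * (\<integral>\<^sup>+x. F i x \<partial>M2)) = c * (SUP i. \<integral>\<^sup>+x. F i x \<partial>M2)"
    by (simp add: SUP_mult_left_ennreal)
  finally show ?case
    by (simp only: lim[OF refl] lim[OF sets(1)] lim[OF sets(2)])
qed

text \<open>
  The splitting technique of Athreya, Ney and Nummelin: a kernel bounded below by \<open>s z * \<nu>\<close>
  regenerates from \<open>\<nu>\<close> with probability \<open>s z\<close> and otherwise follows the sub-Markov kernel
  \<open>T = Q - s \<otimes> \<nu>\<close>.
\<close>
locale minorized_kernel =
  fixes Q :: "'b::topological_space \<Rightarrow> 'b measure" and s :: "'b \<Rightarrow> ennreal" and \<nu> :: "'b measure"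
  assumes Q_kernel: "Q \<in> borel \<rightarrow>\<^sub>M subprob_algebra borel"
    and Q_prob: "\<And>z. prob_space (Q z)"
    and \<nu>_prob: "prob_space \<nu>" and \<nu>_sets: "sets \<nu> = sets borel"
    and s_measurable [measurable]: "s \<in> borel_measurable borel"
    and minorization: "\<And>z A. A \<in> sets borel \<Longrightarrow> s z * emeasure \<nu> A \<le> emeasure (Q z) A"
begin

declare Q_kernel [measurable] \<nu>_sets [measurable_cong, simp]

lemma Q_sets [measurable_cong, simp]: "sets (Q z) = sets borel"
  using subprob_measurableD(2)[OF Q_kernel] by simp

lemma Q_space [simp]: "space (Q z) = UNIV"
  using sets_eq_imp_space_eq[OF Q_sets] by simp

lemma \<nu>_space [simp]: "space \<nu> = UNIV"
  using sets_eq_imp_space_eq[OF \<nu>_sets] by simp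

lemma Q_mass [simp]: "emeasure (Q z) UNIV = 1"
  using prob_space.emeasure_space_1[OF Q_prob] by simp

lemma \<nu>_mass [simp]: "emeasure \<nu> UNIV = 1"
  using prob_space.emeasure_space_1[OF \<nu>_prob] by simp

lemma s_le_1: "s z \<le> 1"
  using minorization[of UNIV z] by simp

definition T :: "'b \<Rightarrow> 'b measure" where
  "T z = diff_measure (Q z) (scale_measure (s z) \<nu>)"

lemma T_sets [measurable_cong, simp]: "sets (T z) = sets borel"
  by (simp add: T_def)

lemma T_space [simp]: "space (T z) = UNIV"
  using sets_eq_imp_space_eq[OF T_sets] by simp

lemma s_finite: "s z < \<top>"
  using s_le_1[of z] by (simp add: le_less_trans[OF _ ennreal_one_less_top])

lemma emeasure_T:
  assumes [measurable]: "A \<in> sets borel"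
  shows "emeasure (T z) A = emeasure (Q z) A - s z * emeasure \<nu> A"
proof -
  have "finite_measure (Q z)" using Q_prob by (rule prob_space.finite_measure)
  moreover have "finite_measure (scale_measure (s z) \<nu>)"
    using s_finite[of z] by (intro finite_measureI) (auto simp: space_scale_measure)
  ultimately show ?thesis
    unfolding T_def using minorization by (subst emeasure_diff_measure) auto
qed

lemma Q_split:
  assumes "A \<in> sets borel"
  shows "emeasure (Q z) A = emeasure (T z) A + s z * emeasure \<nu> A"
  using minorization[OF assms, of z] by (simp add: emeasure_T[OF assms] diff_add_cancel_ennreal)

lemma T_le_Q: "A \<in> sets borel \<Longrightarrow> emeasure (T z) A \<le> emeasure (Q z) A"
  by (simp add: Q_split)

lemma T_subprob: "subprob_space (T z)"
proof
  show "emeasure (T z) (space (T z)) \<le> 1"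
    using T_le_Q[of UNIV z] by simp
qed simp

lemma T_kernel [measurable]: "T \<in> borel \<rightarrow>\<^sub>M subprob_algebra borel"
proof (rule measurable_subprob_algebra)
  fix A :: "'b set" assume [measurable]: "A \<in> sets borel"
  have "(\<lambda>z. emeasure (Q z) A - s z * emeasure \<nu> A) \<in> borel_measurable borel"
    by measurable
  then show "(\<lambda>z. emeasure (T z) A) \<in> borel_measurable borel"
    by (simp add: emeasure_T)
qed (use T_subprob in auto)

lemma nn_integral_Q:
  assumes "f \<in> borel_measurable borel"
  shows "(\<integral>\<^sup>+x. f x \<partial>Q z) = (\<integral>\<^sup>+x. f x \<partial>T z) + s z * (\<integral>\<^sup>+x. f x \<partial>\<nu>)"
  using assms by (intro nn_integral_split_measure Q_split) auto

primrec Tpow :: "nat \<Rightarrow> 'b \<Rightarrow> 'b measure" where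
  "Tpow 0 z = return borel z"
| "Tpow (Suc n) z = Tpow n z \<bind> T"

lemma Tpow_kernel [measurable]: "Tpow n \<in> borel \<rightarrow>\<^sub>M subprob_algebra borel"
proof (induction n)
  case 0
  then show ?case by (simp add: Tpow.simps[abs_def] return_measurable)
next
  case (Suc n)
  then show ?case
    unfolding Tpow.simps by (intro measurable_bind2[OF _ T_kernel])
qed

lemma Tpow_sets [measurable_cong, simp]: "sets (Tpow n z) = sets borel"
  using subprob_measurableD(2)[OF Tpow_kernel] by simp

lemma Tpow_space [simp]: "space (Tpow n z) = UNIV"
  using sets_eq_imp_space_eq[OF Tpow_sets] by simp

lemma Tpow_Suc_shift: "Tpow (Suc n) z = T z \<bind> Tpow n"
proof (induction n arbitrary: z)
  case 0
  show ?case
    by (simp add: bind_return[OF T_kernel] bind_return'' Tpow.simps(1)[abs_def] del: Tpow.simps)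
       (simp add: Tpow.simps bind_return[OF T_kernel] bind_return'')
next
  case (Suc n)
  have "Tpow (Suc (Suc n)) z = (T z \<bind> Tpow n) \<bind> T"
    using Suc by simp
  also have "\<dots> = T z \<bind> (\<lambda>y. Tpow n y \<bind> T)"
    by (rule bind_assoc[OF _ T_kernel]) (simp cong: measurable_cong_sets add: Tpow_kernel)
  finally show ?case by (simp add: Tpow.simps(2)[abs_def])
qed

text \<open>
  The law \<open>n\<close> steps after a regeneration, restricted to the event that none has happened since.
\<close>
definition \<mu> :: "nat \<Rightarrow> 'b measure" where
  "\<mu> n = \<nu> \<bind> Tpow n"

lemma \<mu>_0: "\<mu> 0 = \<nu>"
  unfolding \<mu>_def by (simp add: Tpow.simps(1)[abs_def] bind_return'')

lemma \<mu>_Suc: "\<mu> (Suc n) = \<mu> n \<bind> T"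
  unfolding \<mu>_def Tpow.simps
  by (rule bind_assoc[symmetric, OF _ T_kernel]) (simp cong: measurable_cong_sets add: Tpow_kernel)

lemma Tpow_kernel': "Tpow n \<in> \<nu> \<rightarrow>\<^sub>M subprob_algebra borel"
  using Tpow_kernel[of n] by (simp cong: measurable_cong_sets)

lemma \<mu>_subprob: "subprob_space (\<mu> n)"
  unfolding \<mu>_def
  by (intro subprob_space_bind[OF _ Tpow_kernel'] prob_space_imp_subprob_space \<nu>_prob)

lemma \<mu>_sets [measurable_cong, simp]: "sets (\<mu> n) = sets borel"
  unfolding \<mu>_def by (rule sets_bind[OF Tpow_sets]) simp

lemma \<mu>_space [simp]: "space (\<mu> n) = UNIV"
  using sets_eq_imp_space_eq[OF \<mu>_sets] by simp

lemma T_kernel': "sets N = sets borel \<Longrightarrow> T \<in> N \<rightarrow>\<^sub>M subprob_algebra borel"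
  using T_kernel by (simp cong: measurable_cong_sets)

text \<open>
  The expected occupation measure of one excursion between regenerations, that is \<open>\<Sum>n. \<mu> n\<close>. Binding
  over the counting measure provides countable additivity and the formula for integrals.
\<close>
definition \<pi>0 :: "'b measure" where
  "\<pi>0 = count_space UNIV \<bind> \<mu>"

lemma \<mu>_measurable: "\<mu> \<in> count_space UNIV \<rightarrow>\<^sub>M subprob_algebra borel"
  by (auto simp: space_subprob_algebra \<mu>_subprob)

lemma \<pi>0_sets [measurable_cong, simp]: "sets \<pi>0 = sets borel"
  unfolding \<pi>0_def by (rule sets_bind) auto

lemma \<pi>0_space [simp]: "space \<pi>0 = UNIV"
  using sets_eq_imp_space_eq[OF \<pi>0_sets] by simp

lemma emeasure_\<pi>0:
  assumes "A \<in> sets borel"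
  shows "emeasure \<pi>0 A = (\<Sum>n. emeasure (\<mu> n) A)"
  unfolding \<pi>0_def
  by (subst emeasure_bind[OF _ \<mu>_measurable assms]) (auto simp: nn_integral_count_space_nat)

lemma nn_integral_\<pi>0:
  assumes "f \<in> borel_measurable borel"
  shows "(\<integral>\<^sup>+x. f x \<partial>\<pi>0) = (\<Sum>n. \<integral>\<^sup>+x. f x \<partial>\<mu> n)"
  unfolding \<pi>0_def
  by (subst nn_integral_bind[OF assms \<mu>_measurable]) (auto simp: nn_integral_count_space_nat)

lemma Q_kernel': "sets N = sets borel \<Longrightarrow> Q \<in> N \<rightarrow>\<^sub>M subprob_algebra borel"
  using Q_kernel by (simp cong: measurable_cong_sets)

lemma emeasure_bind_Q:
  assumes "sets N = sets borel" "A \<in> sets borel"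
  shows "emeasure (N \<bind> Q) A = (\<integral>\<^sup>+z. emeasure (Q z) A \<partial>N)"
  using sets_eq_imp_space_eq[OF assms(1)] by (intro emeasure_bind[OF _ Q_kernel'] assms) auto

lemma \<pi>0_shift:
  assumes [measurable]: "A \<in> sets borel"
  shows "emeasure \<pi>0 A = emeasure \<nu> A + (\<integral>\<^sup>+z. emeasure (T z) A \<partial>\<pi>0)"
proof -
  have "(\<integral>\<^sup>+z. emeasure (T z) A \<partial>\<pi>0) = (\<Sum>n. \<integral>\<^sup>+z. emeasure (T z) A \<partial>\<mu> n)"
    by (rule nn_integral_\<pi>0) measurable
  also have "\<dots> = (\<Sum>n. emeasure (\<mu> (Suc n)) A)"
    unfolding \<mu>_Suc by (subst emeasure_bind[OF _ T_kernel']) auto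
  finally show ?thesis
    using suminf_offset[of "\<lambda>n. emeasure (\<mu> n) A" 1]
    by (simp add: emeasure_\<pi>0 \<mu>_0)
qed

text \<open>
  From \<open>\<pi>0 = \<nu> + \<pi>0 T\<close> one gets \<open>\<pi>0 Q = \<pi>0 - \<nu> + \<pi>0(s) \<nu>\<close>. As \<open>Q\<close> preserves the finite total mass, \<open>\<pi>0(s) = 1\<close>.
\<close>
lemma \<pi>0_fixed:
  assumes fin: "emeasure \<pi>0 UNIV < \<top>"
  shows "\<pi>0 \<bind> Q = \<pi>0"
proof -
  define c where "c = (\<integral>\<^sup>+z. s z \<partial>\<pi>0)"
  have Q: "emeasure (\<pi>0 \<bind> Q) A = (\<integral>\<^sup>+z. emeasure (T z) A \<partial>\<pi>0) + c * emeasure \<nu> A"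
    if [measurable]: "A \<in> sets borel" for A
  proof -
    have "emeasure (\<pi>0 \<bind> Q) A = (\<integral>\<^sup>+z. emeasure (T z) A + s z * emeasure \<nu> A \<partial>\<pi>0)"
      by (simp add: emeasure_bind_Q Q_split)
    also have "\<dots> = (\<integral>\<^sup>+z. emeasure (T z) A \<partial>\<pi>0) + c * emeasure \<nu> A"
      unfolding c_def by (subst nn_integral_add) (auto simp: nn_integral_multc)
    finally show ?thesis .
  qed
  let ?t = "\<integral>\<^sup>+z. emeasure (T z) UNIV \<partial>\<pi>0"
  have "emeasure (\<pi>0 \<bind> Q) UNIV = emeasure \<pi>0 UNIV"
    by (simp add: emeasure_bind_Q)
  then have "?t + c = 1 + ?t"
    using Q[of UNIV] \<pi>0_shift[of UNIV] by simp
  moreover have "?t < \<top>"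
    using fin \<pi>0_shift[of UNIV] by (simp add: less_top[symmetric])
  ultimately have "c = 1"
    by (metis ennreal_add_left_cancel add.commute less_top_ennreal less_irrefl infinity_ennreal_def)
  then have "emeasure (\<pi>0 \<bind> Q) A = emeasure \<pi>0 A" if "A \<in> sets borel" for A
    using Q[OF that] \<pi>0_shift[OF that] by (simp add: add.commute)
  then show ?thesis
    by (intro measure_eqI) (auto simp: sets_bind[OF Q_sets])
qed

text \<open>
  Decomposition of a stationary chain at its last regeneration during \<open>N\<close> steps.
\<close>
lemma invariant_iterate:
  assumes inv: "invariant_law Q \<pi>" and [measurable]: "A \<in> sets borel"
  shows "emeasure \<pi> A = (\<integral>\<^sup>+z. emeasure (Tpow N z) A \<partial>\<pi>)
    + (\<integral>\<^sup>+z. s z \<partial>\<pi>) * (\<Sum>n<N. emeasure (\<mu> n) A)"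
proof (induction N)
  case 0
  have [measurable_cong]: "sets \<pi> = sets borel" using inv by (simp add: invariant_law_def)
  show ?case by (simp add: emeasure_return[OF assms(2)])
next
  case (Suc N)
  have sp [measurable_cong, simp]: "sets \<pi> = sets borel" and fixed: "\<pi> \<bind> Q = \<pi>"
    using inv by (simp_all add: invariant_law_def)
  have "(\<integral>\<^sup>+z. emeasure (Tpow N z) A \<partial>\<pi>) = (\<integral>\<^sup>+y. \<integral>\<^sup>+z. emeasure (Tpow N z) A \<partial>Q y \<partial>\<pi>)"
    by (subst fixed[symmetric], rule nn_integral_bind[OF _ Q_kernel']) auto
  also have "\<dots> = (\<integral>\<^sup>+y. (\<integral>\<^sup>+z. emeasure (Tpow N z) A \<partial>T y)
      + s y * (\<integral>\<^sup>+z. emeasure (Tpow N z) A \<partial>\<nu>) \<partial>\<pi>)"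
    by (intro nn_integral_cong nn_integral_Q) measurable
  also have "(\<lambda>y. \<integral>\<^sup>+z. emeasure (Tpow N z) A \<partial>T y) = (\<lambda>y. emeasure (Tpow (Suc N) y) A)"
    unfolding Tpow_Suc_shift
    by (subst emeasure_bind[where N = borel]) (auto cong: measurable_cong_sets simp: Tpow_kernel)
  also have "(\<integral>\<^sup>+z. emeasure (Tpow N z) A \<partial>\<nu>) = emeasure (\<mu> N) A"
    unfolding \<mu>_def by (subst emeasure_bind[OF _ Tpow_kernel']) auto
  also have "(\<integral>\<^sup>+y. emeasure (Tpow (Suc N) y) A + s y * emeasure (\<mu> N) A \<partial>\<pi>)
    = (\<integral>\<^sup>+y. emeasure (Tpow (Suc N) y) A \<partial>\<pi>) + (\<integral>\<^sup>+y. s y \<partial>\<pi>) * emeasure (\<mu> N) A"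
    by (subst nn_integral_add) (auto simp: nn_integral_multc simp del: Tpow.simps)
  finally show ?case
    using Suc by (simp add: distrib_left ac_simps del: Tpow.simps)
qed

text \<open>
  A weight \<open>W \<ge> 1\<close> that decays geometrically under \<open>T\<close> bounds the mass of the excursions that survive
  \<open>n\<close> steps; it takes the place of estimates for return times.
\<close>
context
  fixes W :: "'b \<Rightarrow> real" and \<rho> :: real
  assumes W_measurable [measurable]: "W \<in> borel_measurable borel"
    and W_ge_1: "\<And>z. 1 \<le> W z"
    and \<rho>: "0 \<le> \<rho>" "\<rho> < 1"
    and W_decay: "\<And>z. (\<integral>\<^sup>+x. W x \<partial>T z) \<le> ennreal (\<rho> * W z)"
begin

lemma Tpow_W_decay: "(\<integral>\<^sup>+x. W x \<partial>Tpow n z) \<le> ennreal (\<rho> ^ n * W z)"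
proof (induction n)
  case (Suc n)
  have "(\<integral>\<^sup>+x. W x \<partial>Tpow (Suc n) z) = (\<integral>\<^sup>+y. \<integral>\<^sup>+x. W x \<partial>T y \<partial>Tpow n z)"
    unfolding Tpow.simps by (rule nn_integral_bind[OF _ T_kernel']) auto
  also have "\<dots> \<le> (\<integral>\<^sup>+y. ennreal (\<rho> * W y) \<partial>Tpow n z)"
    by (intro nn_integral_mono W_decay)
  also have "\<dots> = ennreal \<rho> * (\<integral>\<^sup>+y. W y \<partial>Tpow n z)"
    using \<rho> W_ge_1 by (simp add: ennreal_mult' nn_integral_cmult)
  also have "\<dots> \<le> ennreal \<rho> * ennreal (\<rho> ^ n * W z)"
    by (intro mult_left_mono Suc) simp
  also have "\<dots> = ennreal (\<rho> ^ Suc n * W z)"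
    using \<rho> by (simp add: ennreal_mult'[symmetric] mult_ac)
  finally show ?case .
qed (simp add: nn_integral_return)

lemma Tpow_mass_tendsto_0:
  assumes [measurable]: "A \<in> sets borel"
  shows "(\<lambda>n. emeasure (Tpow n z) A) \<longlonglongrightarrow> 0"
proof (rule tendsto_sandwich[where f = "\<lambda>_. 0"])
  show "\<forall>\<^sub>F n in sequentially. emeasure (Tpow n z) A \<le> ennreal (\<rho> ^ n * W z)"
  proof (intro always_eventually allI)
    fix n
    have "emeasure (Tpow n z) A = (\<integral>\<^sup>+x. indicator A x \<partial>Tpow n z)"
      by simp
    also have "\<dots> \<le> (\<integral>\<^sup>+x. W x \<partial>Tpow n z)"
      using W_ge_1 by (intro nn_integral_mono) (auto simp: indicator_def)
    also note Tpow_W_decay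
    finally show "emeasure (Tpow n z) A \<le> ennreal (\<rho> ^ n * W z)" .
  qed
  have "(\<lambda>n. \<rho> ^ n * W z) \<longlonglongrightarrow> 0"
    using \<rho> by (intro tendsto_mult_left_zero LIMSEQ_realpow_zero)
  then show "(\<lambda>n. ennreal (\<rho> ^ n * W z)) \<longlonglongrightarrow> 0"
    using tendsto_ennrealI by fastforce
qed auto

lemma nn_integral_\<pi>0_W:
  assumes "(\<integral>\<^sup>+x. W x \<partial>\<nu>) < \<top>"
  shows "(\<integral>\<^sup>+x. W x \<partial>\<pi>0) < \<top>"
proof -
  have bound: "(\<integral>\<^sup>+x. W x \<partial>\<mu> n) \<le> ennreal (\<rho> ^ n) * (\<integral>\<^sup>+x. W x \<partial>\<nu>)" for n
  proof -
    have "(\<integral>\<^sup>+x. W x \<partial>\<mu> n) = (\<integral>\<^sup>+z. \<integral>\<^sup>+x. W x \<partial>Tpow n z \<partial>\<nu>)"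
      unfolding \<mu>_def by (rule nn_integral_bind[OF _ Tpow_kernel']) auto
    also have "\<dots> \<le> (\<integral>\<^sup>+z. ennreal (\<rho> ^ n * W z) \<partial>\<nu>)"
      by (intro nn_integral_mono Tpow_W_decay)
    also have "\<dots> = ennreal (\<rho> ^ n) * (\<integral>\<^sup>+x. W x \<partial>\<nu>)"
      using \<rho> by (simp add: ennreal_mult' nn_integral_cmult)
    finally show ?thesis .
  qed
  have "(\<integral>\<^sup>+x. W x \<partial>\<pi>0) = (\<Sum>n. \<integral>\<^sup>+x. W x \<partial>\<mu> n)"
    by (rule nn_integral_\<pi>0) measurable
  also have "\<dots> \<le> (\<Sum>n. ennreal (\<rho> ^ n) * (\<integral>\<^sup>+x. W x \<partial>\<nu>))"
    by (intro suminf_le bound) auto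
  also have "\<dots> = (\<Sum>n. ennreal (\<rho> ^ n)) * (\<integral>\<^sup>+x. W x \<partial>\<nu>)"
    by simp
  also have "(\<Sum>n. ennreal (\<rho> ^ n)) = ennreal (1 / (1 - \<rho>))"
    using \<rho> by (intro suminf_ennreal_eq geometric_sums) auto
  also have "ennreal (1 / (1 - \<rho>)) * (\<integral>\<^sup>+x. W x \<partial>\<nu>) < \<top>"
    using assms by (simp add: ennreal_mult_less_top)
  finally show ?thesis .
qed

text \<open>
  The part of \<open>\<pi>\<close> that has not regenerated within \<open>N\<close> steps vanishes as \<open>N\<close> grows, by dominated
  convergence. So every invariant law is proportional to \<open>\<pi>0\<close>, which is the source of uniqueness.
\<close>
lemma invariant_eq_\<pi>0:
  assumes inv: "invariant_law Q \<pi>" and [measurable]: "A \<in> sets borel"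
  shows "emeasure \<pi> A = (\<integral>\<^sup>+z. s z \<partial>\<pi>) * emeasure \<pi>0 A"
proof (rule LIMSEQ_unique)
  have [measurable_cong, simp]: "sets \<pi> = sets borel" and "prob_space \<pi>"
    using inv by (simp_all add: invariant_law_def)
  then interpret \<pi>: prob_space \<pi> by simp
  have "(\<lambda>N. \<integral>\<^sup>+z. emeasure (Tpow N z) A \<partial>\<pi>) \<longlonglongrightarrow> (\<integral>\<^sup>+z. 0 \<partial>\<pi>)"
  proof (rule nn_integral_dominated_convergence[where w = "\<lambda>_. 1"])
    have "emeasure (Tpow N z) A \<le> 1" for N z
      using subprob_space.subprob_emeasure_le_1[OF subprob_space_kernel[OF Tpow_kernel]] by simp
    then show "AE z in \<pi>. emeasure (Tpow N z) A \<le> 1" for N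
      by simp
    show "AE z in \<pi>. (\<lambda>N. emeasure (Tpow N z) A) \<longlonglongrightarrow> 0"
      by (simp add: Tpow_mass_tendsto_0)
  qed (auto simp: \<pi>.emeasure_space_1)
  moreover have "(\<lambda>N. \<Sum>n<N. emeasure (\<mu> n) A) \<longlonglongrightarrow> emeasure \<pi>0 A"
    unfolding emeasure_\<pi>0[OF assms(2)] by (rule summable_LIMSEQ) simp
  moreover have "(\<integral>\<^sup>+z. s z \<partial>\<pi>) < \<top>"
  proof -
    have "(\<integral>\<^sup>+z. s z \<partial>\<pi>) \<le> (\<integral>\<^sup>+z. 1 \<partial>\<pi>)"
      by (intro nn_integral_mono s_le_1)
    then show ?thesis
      using \<pi>.emeasure_space_1 by (simp add: le_less_trans[OF _ ennreal_one_less_top])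
  qed
  ultimately have "(\<lambda>N. (\<integral>\<^sup>+z. emeasure (Tpow N z) A \<partial>\<pi>)
      + (\<integral>\<^sup>+z. s z \<partial>\<pi>) * (\<Sum>n<N. emeasure (\<mu> n) A))
    \<longlonglongrightarrow> (\<integral>\<^sup>+z. 0 \<partial>\<pi>) + (\<integral>\<^sup>+z. s z \<partial>\<pi>) * emeasure \<pi>0 A"
    by (intro tendsto_add ennreal_tendsto_cmult)
  then show "(\<lambda>N. emeasure \<pi> A) \<longlonglongrightarrow> (\<integral>\<^sup>+z. s z \<partial>\<pi>) * emeasure \<pi>0 A"
    using invariant_iterate[OF inv assms(2)] by simp
qed simp

theorem ex1_invariant_law:
  assumes W_fin: "(\<integral>\<^sup>+x. W x \<partial>\<nu>) < \<top>"
  shows "\<exists>\<pi>. invariant_law Q \<pi> \<and> (\<integral>\<^sup>+x. W x \<partial>\<pi>) < \<top> \<and> (\<forall>\<pi>'. invariant_law Q \<pi>' \<longrightarrow> \<pi>' = \<pi>)"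
proof -
  define m where "m = emeasure \<pi>0 UNIV"
  have "m = (\<integral>\<^sup>+x. ennreal 1 \<partial>\<pi>0)" by (simp add: m_def)
  also have "\<dots> \<le> (\<integral>\<^sup>+x. W x \<partial>\<pi>0)"
    using W_ge_1 by (intro nn_integral_mono ennreal_leI)
  also note nn_integral_\<pi>0_W[OF W_fin]
  finally have m_fin: "m < \<top>" .
  have m_pos: "m \<noteq> 0"
    using \<pi>0_shift[of UNIV] by (auto simp: m_def)
  define \<pi> where "\<pi> = scale_measure (1 / m) \<pi>0"
  have \<pi>_sets: "sets \<pi> = sets borel" by (simp add: \<pi>_def)
  have mm: "1 / m * m = 1"
    using m_fin m_pos by (simp add: ennreal_divide_times ennreal_divide_self)
  have prob: "prob_space \<pi>"
    by (rule prob_spaceI) (simp add: \<pi>_def space_scale_measure mm flip: m_def)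
  have "\<pi> \<bind> Q = \<pi>"
  proof (rule measure_eqI)
    fix A assume "A \<in> sets (\<pi> \<bind> Q)"
    then have A [measurable]: "A \<in> sets borel"
      using sets_eq_imp_space_eq[OF \<pi>_sets] by (simp add: sets_bind[OF Q_sets])
    have "emeasure (\<pi> \<bind> Q) A = 1 / m * (\<integral>\<^sup>+z. emeasure (Q z) A \<partial>\<pi>0)"
      unfolding emeasure_bind_Q[OF \<pi>_sets A] unfolding \<pi>_def
      by (rule nn_integral_scale_measure) measurable
    also have "\<dots> = 1 / m * emeasure (\<pi>0 \<bind> Q) A"
      by (simp add: emeasure_bind_Q)
    also have "\<dots> = emeasure \<pi> A"
      using m_fin by (subst \<pi>0_fixed) (auto simp: \<pi>_def m_def)
    finally show "emeasure (\<pi> \<bind> Q) A = emeasure \<pi> A" .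
  qed (use sets_eq_imp_space_eq[OF \<pi>_sets] \<pi>_sets in \<open>simp add: sets_bind[OF Q_sets]\<close>)
  then have inv: "invariant_law Q \<pi>"
    using prob \<pi>_sets by (simp add: invariant_law_def)
  have fin: "(\<integral>\<^sup>+x. W x \<partial>\<pi>) < \<top>"
  proof -
    have "(\<integral>\<^sup>+x. W x \<partial>\<pi>) = 1 / m * (\<integral>\<^sup>+x. W x \<partial>\<pi>0)"
      unfolding \<pi>_def by (rule nn_integral_scale_measure) measurable
    also have "\<dots> < \<top>"
    proof -
      have "1 / m < \<top>"
        using m_pos by (simp add: ennreal_divide_eq_top_iff less_top[symmetric])
      then show ?thesis
        using nn_integral_\<pi>0_W[OF W_fin] by (simp only: ennreal_mult_less_top) simp
    qed
    finally show ?thesis .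
  qed
  have uniq: "\<pi>' = \<pi>" if inv': "invariant_law Q \<pi>'" for \<pi>'
  proof (rule measure_eqI)
    define c where "c = (\<integral>\<^sup>+z. s z \<partial>\<pi>')"
    have \<pi>'_sets: "sets \<pi>' = sets borel" and "prob_space \<pi>'"
      using inv' by (simp_all add: invariant_law_def)
    then have "emeasure \<pi>' UNIV = 1"
      using prob_space.emeasure_space_1[of \<pi>'] sets_eq_imp_space_eq[OF \<pi>'_sets] by simp
    then have "c * m = 1"
      using invariant_eq_\<pi>0[OF inv', of UNIV] by (simp add: c_def m_def)
    then have "c = 1 / m"
      using m_pos m_fin
      by (metis ennreal_divide_self mult.right_neutral mult_divide_eq_ennreal less_top)
    then show "emeasure \<pi>' A = emeasure \<pi> A" if "A \<in> sets \<pi>'" for A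
      using invariant_eq_\<pi>0[OF inv', of A] that \<pi>'_sets by (simp add: c_def \<pi>_def)
    show "sets \<pi>' = sets \<pi>" using \<pi>'_sets \<pi>_sets by simp
  qed
  show ?thesis using inv fin uniq by blast
qed

end

end

text \<open>
  Harris's theorem in the form of Hairer and Mattingly, without the rate of convergence. The function
  \<open>W = 1 + b V\<close> decays geometrically under the residual kernel: on the sublevel set the mass \<open>\<epsilon>\<close> removed from
  \<open>Q\<close> compensates for the constant \<open>b K = \<epsilon> / 2\<close>, and outside it \<open>V\<close> is so large that the drift does.
  The explicit moment bound follows by integrating the drift condition once \<open>V\<close> is known to be integrable.
\<close>
theorem harris_invariant_law:
  fixes Q :: "'b::topological_space \<Rightarrow> 'b measure" and V :: "'b \<Rightarrow> real"
  assumes Q_kernel: "Q \<in> borel \<rightarrow>\<^sub>M subprob_algebra borel"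
    and Q_prob: "\<And>z. prob_space (Q z)"
    and \<nu>_prob: "prob_space \<nu>" and \<nu>_sets: "sets \<nu> = sets borel"
    and V_measurable [measurable]: "V \<in> borel_measurable borel"
    and V_nonneg: "\<And>z. 0 \<le> V z"
    and \<rho>: "0 \<le> \<rho>" "\<rho> < 1" and K: "0 < K"
    and drift: "\<And>z. (\<integral>\<^sup>+x. V x \<partial>Q z) \<le> ennreal (\<rho> * V z + K)"
    and M: "4 * K / (1 - \<rho>) \<le> M"
    and \<epsilon>: "0 < \<epsilon>" "\<epsilon> \<le> 1"
    and minor: "\<And>z A. V z \<le> M \<Longrightarrow> A \<in> sets borel \<Longrightarrow> ennreal \<epsilon> * emeasure \<nu> A \<le> emeasure (Q z) A"
    and small_point: "V z\<^sub>0 \<le> M"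
  shows "\<exists>\<pi>. invariant_law Q \<pi> \<and> (\<forall>\<pi>'. invariant_law Q \<pi>' \<longrightarrow> \<pi>' = \<pi>)
    \<and> (\<integral>\<^sup>+x. V x \<partial>\<pi>) \<le> ennreal (K / (1 - \<rho>))"
proof -
  define s where "s z = ennreal (if V z \<le> M then \<epsilon> else 0)" for z
  interpret minorized_kernel Q s \<nu>
  proof (rule minorized_kernel.intro)
    show "s \<in> borel_measurable borel" unfolding s_def by measurable
    show "s z * emeasure \<nu> A \<le> emeasure (Q z) A" if "A \<in> sets borel" for z A
      using minor[OF _ that] by (auto simp: s_def)
  qed (fact Q_kernel Q_prob \<nu>_prob \<nu>_sets)+
  define b where "b = \<epsilon> / (2 * K)"
  define \<delta> where "\<delta> = min (\<epsilon> / 2) ((1 - \<rho>) / 2)"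
  define W where "W z = 1 + b * V z" for z
  have b: "0 < b" "b * K = \<epsilon> / 2" using \<epsilon> K by (auto simp: b_def)
  have \<delta>: "0 < \<delta>" "\<delta> \<le> \<epsilon> / 2" "\<delta> \<le> (1 - \<rho>) / 2" 
    using \<epsilon> \<rho> unfolding \<delta>_def by (simp, simp only: min.cobounded1, simp only: min.cobounded2)
  have W_meas [measurable]: "W \<in> borel_measurable borel" unfolding W_def by measurable
  have W_ge: "1 \<le> W z" for z using b V_nonneg by (simp add: W_def)
  have split_W: "(\<integral>\<^sup>+x. W x \<partial>N) = emeasure N UNIV + ennreal b * (\<integral>\<^sup>+x. V x \<partial>N)"
    if "sets N = sets borel" for N :: "'b measure"
  proof -
    have [measurable]: "V \<in> borel_measurable N" using that by (simp cong: measurable_cong_sets)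
    have "(\<integral>\<^sup>+x. W x \<partial>N) = (\<integral>\<^sup>+x. 1 + ennreal b * ennreal (V x) \<partial>N)"
      using b V_nonneg by (intro nn_integral_cong) (simp add: W_def ennreal_mult flip: ennreal_1)
    also have "\<dots> = emeasure N UNIV + ennreal b * (\<integral>\<^sup>+x. V x \<partial>N)"
      using sets_eq_imp_space_eq[OF that]
      by (subst nn_integral_add) (auto simp: nn_integral_cmult)
    finally show ?thesis .
  qed
  have decay: "(\<integral>\<^sup>+x. W x \<partial>T z) \<le> ennreal ((1 - \<delta>) * W z)" for z
  proof -
    let ?s = "if V z \<le> M then \<epsilon> else 0"
    have "(\<integral>\<^sup>+x. V x \<partial>T z) \<le> (\<integral>\<^sup>+x. V x \<partial>Q z)"
      using T_le_Q by (intro nn_integral_mono_measure) (auto simp: le_measure)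
    also note drift
    finally have "(\<integral>\<^sup>+x. V x \<partial>T z) \<le> ennreal (\<rho> * V z + K)" .
    moreover have "emeasure (T z) UNIV = ennreal (1 - ?s)"
      using \<epsilon> ennreal_minus[of \<epsilon> 1] by (simp add: emeasure_T s_def)
    ultimately have "(\<integral>\<^sup>+x. W x \<partial>T z) \<le> ennreal (1 - ?s) + ennreal b * ennreal (\<rho> * V z + K)"
      by (simp add: split_W add_left_mono mult_left_mono)
    also have "\<dots> = ennreal (1 - ?s + b * (\<rho> * V z + K))"
      using \<epsilon> b \<rho> K V_nonneg[of z]
      by (simp add: ennreal_mult'[symmetric] ennreal_plus[symmetric] del: ennreal_plus)
    also have "\<dots> \<le> ennreal ((1 - \<delta>) * W z)"
    proof (rule ennreal_leI)
      have gap: "b * V z * ((1 - \<rho>) / 2) \<le> b * V z * (1 - \<delta> - \<rho>)"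
        using \<delta> b V_nonneg[of z] by (intro mult_left_mono) auto
      have goal_eq: "(1 - \<delta>) * W z - (1 - ?s + b * (\<rho> * V z + K))
          = b * V z * (1 - \<delta> - \<rho>) - \<delta> - \<epsilon> / 2 + ?s"
        using b(2) by (simp add: W_def algebra_simps)
      have "\<delta> + \<epsilon> / 2 \<le> b * V z * (1 - \<delta> - \<rho>) + ?s"
      proof (cases "V z \<le> M")
        case True
        have "0 \<le> b * V z * ((1 - \<rho>) / 2)" using b \<rho> V_nonneg[of z] by simp
        with gap True \<delta> show ?thesis by simp
      next
        case False
        have "\<epsilon> = b * (4 * K / (1 - \<rho>)) * ((1 - \<rho>) / 2)"
          using \<rho> K by (simp add: b_def)
        also have "\<dots> \<le> b * V z * ((1 - \<rho>) / 2)"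
          using False M b \<rho> by (intro mult_right_mono mult_left_mono) auto
        finally show ?thesis using gap \<delta> False by simp
      qed
      then show "1 - ?s + b * (\<rho> * V z + K) \<le> (1 - \<delta>) * W z"
        using goal_eq by linarith
    qed
    finally show ?thesis .
  qed
  have "(\<integral>\<^sup>+x. V x \<partial>\<nu>) < \<top>"
  proof -
    have "(\<integral>\<^sup>+x. V x \<partial>T z\<^sub>0) + s z\<^sub>0 * (\<integral>\<^sup>+x. V x \<partial>\<nu>) \<le> ennreal (\<rho> * V z\<^sub>0 + K)"
      using drift[of z\<^sub>0] by (subst nn_integral_Q[symmetric]) auto
    also have "\<dots> < \<top>" by simp
    finally have "s z\<^sub>0 * (\<integral>\<^sup>+x. V x \<partial>\<nu>) < \<top>" by simp
    moreover have "s z\<^sub>0 = ennreal \<epsilon>" using small_point by (simp add: s_def)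
    ultimately show ?thesis
      using \<epsilon> by (auto simp: ennreal_mult_less_top)
  qed
  then have "(\<integral>\<^sup>+x. W x \<partial>\<nu>) < \<top>"
    by (simp add: split_W ennreal_mult_less_top)
  then have "\<exists>\<pi>. invariant_law Q \<pi> \<and> (\<integral>\<^sup>+x. W x \<partial>\<pi>) < \<top>
      \<and> (\<forall>\<pi>'. invariant_law Q \<pi>' \<longrightarrow> \<pi>' = \<pi>)"
    using \<delta> \<epsilon> by (intro ex1_invariant_law[OF W_meas W_ge _ _ decay]) linarith+
  then obtain \<pi> where inv: "invariant_law Q \<pi>" and W_fin: "(\<integral>\<^sup>+x. W x \<partial>\<pi>) < \<top>"
    and uniq: "\<forall>\<pi>'. invariant_law Q \<pi>' \<longrightarrow> \<pi>' = \<pi>"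
    by blast
  have \<pi>_sets [measurable_cong]: "sets \<pi> = sets borel" and "prob_space \<pi>" and fixed: "\<pi> \<bind> Q = \<pi>"
    using inv by (simp_all add: invariant_law_def)
  then have mass: "emeasure \<pi> UNIV = 1"
    using prob_space.emeasure_space_1[of \<pi>] sets_eq_imp_space_eq[OF \<pi>_sets] by simp
  have "(\<integral>\<^sup>+x. V x \<partial>\<pi>) < \<top>"
    using W_fin b by (auto simp: split_W[OF \<pi>_sets] ennreal_mult_less_top)
  then obtain a where a: "0 \<le> a" "(\<integral>\<^sup>+x. V x \<partial>\<pi>) = ennreal a"
    by (cases "\<integral>\<^sup>+x. V x \<partial>\<pi>") auto
  have "ennreal a = (\<integral>\<^sup>+z. \<integral>\<^sup>+x. V x \<partial>Q z \<partial>\<pi>)"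
    unfolding a(2)[symmetric] by (subst fixed[symmetric], rule nn_integral_bind[OF _ Q_kernel'[OF \<pi>_sets]]) auto
  also have "\<dots> \<le> (\<integral>\<^sup>+z. ennreal \<rho> * ennreal (V z) + ennreal K \<partial>\<pi>)"
    using drift \<rho> K V_nonneg by (intro nn_integral_mono) (simp add: ennreal_mult)
  also have "\<dots> = ennreal \<rho> * ennreal a + ennreal K"
    using sets_eq_imp_space_eq[OF \<pi>_sets] mass
    by (subst nn_integral_add) (auto simp: nn_integral_cmult a)
  also have "\<dots> = ennreal (\<rho> * a + K)"
    using \<rho> K a by (simp add: ennreal_mult)
  finally have "a \<le> \<rho> * a + K"
    using \<rho> K a by (subst (asm) ennreal_le_iff) auto
  then have "a \<le> K / (1 - \<rho>)"
    using \<rho> by (simp add: field_simps)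
  then have "(\<integral>\<^sup>+x. V x \<partial>\<pi>) \<le> ennreal (K / (1 - \<rho>))"
    unfolding a(2) by (rule ennreal_leI)
  then show ?thesis
    using inv uniq by blast
qed

section \<open>Staying in a region, total variation and transport to a point mass\<close>

lemma law_after_prob:
  fixes Q :: "'b::topological_space \<Rightarrow> 'b measure"
  assumes Q: "Q \<in> borel \<rightarrow>\<^sub>M subprob_algebra borel" and prob: "\<And>z. prob_space (Q z)"
  shows "prob_space (law_after Q n (dirac z)) \<and> sets (law_after Q n (dirac z)) = sets borel"
proof (induction n)
  case 0
  show ?case by (simp add: law_after_def dirac_def prob_space_return)
next
  case (Suc n)
  let ?\<mu> = "law_after Q n (dirac z)"
  have sets: "sets ?\<mu> = sets borel" using Suc by simp
  have [simp]: "space ?\<mu> = UNIV" using sets_eq_imp_space_eq[OF sets] by simp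
  have eq: "law_after Q (Suc n) (dirac z) = ?\<mu> \<bind> Q" by (simp add: law_after_def)
  have Q': "Q \<in> ?\<mu> \<rightarrow>\<^sub>M subprob_algebra borel"
    using Q sets by (simp cong: measurable_cong_sets)
  have "prob_space (?\<mu> \<bind> Q)"
    using Suc by (intro prob_space.prob_space_bind[OF _ _ Q']) (auto simp: prob)
  moreover have "sets (?\<mu> \<bind> Q) = sets borel"
    using subprob_measurableD(2)[OF Q] by (intro sets_bind) auto
  ultimately show ?case by (simp add: eq)
qed

text \<open>
  The probability of remaining is at least \<open>(1 - p)\<^sup>n\<close>, and Bernoulli's inequality applies.
\<close>
lemma law_after_stays:
  fixes Q :: "'b::topological_space \<Rightarrow> 'b measure"
  assumes Q: "Q \<in> borel \<rightarrow>\<^sub>M subprob_algebra borel" and prob: "\<And>z. prob_space (Q z)"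
    and A: "A \<in> sets borel" and z: "z \<in> A"
    and stay: "\<And>y. y \<in> A \<Longrightarrow> 1 - p \<le> measure (Q y) A" and p: "p \<le> 1"
  shows "1 - real n * p \<le> measure (law_after Q n (dirac z)) A"
proof (induction n)
  case 0
  show ?case using A z by (simp add: law_after_def dirac_def measure_return)
next
  case (Suc n)
  let ?\<mu> = "law_after Q n (dirac z)"
  note \<mu> = law_after_prob[OF Q prob, of n z]
  note \<mu>' = law_after_prob[OF Q prob, of "Suc n" z]
  interpret \<mu>: prob_space ?\<mu> using \<mu> by blast
  interpret \<mu>': prob_space "law_after Q (Suc n) (dirac z)" using \<mu>' by blast
  have sets [measurable_cong]: "sets ?\<mu> = sets borel" using \<mu> by simp
  have [simp]: "space ?\<mu> = UNIV" using sets_eq_imp_space_eq[OF sets] by simp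
  have Q': "Q \<in> ?\<mu> \<rightarrow>\<^sub>M subprob_algebra borel"
    using Q sets by (simp cong: measurable_cong_sets)
  have A' [measurable]: "A \<in> sets ?\<mu>" using A sets by simp
  have "ennreal ((1 - p) * measure ?\<mu> A) = (\<integral>\<^sup>+y. ennreal (1 - p) * indicator A y \<partial>?\<mu>)"
    using p by (simp add: nn_integral_cmult_indicator \<mu>.emeasure_eq_measure ennreal_mult)
  also have "\<dots> \<le> (\<integral>\<^sup>+y. emeasure (Q y) A \<partial>?\<mu>)"
  proof (intro nn_integral_mono)
    fix y
    interpret Qy: prob_space "Q y" by (rule prob)
    show "ennreal (1 - p) * indicator A y \<le> emeasure (Q y) A"
      using stay[of y] by (auto simp: indicator_def Qy.emeasure_eq_measure intro!: ennreal_leI)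
  qed
  also have "\<dots> = emeasure (law_after Q (Suc n) (dirac z)) A"
  proof -
    have "law_after Q (Suc n) (dirac z) = ?\<mu> \<bind> Q" by (simp add: law_after_def)
    then show ?thesis using emeasure_bind[OF _ Q' A] by simp
  qed
  finally have "(1 - p) * measure ?\<mu> A \<le> measure (law_after Q (Suc n) (dirac z)) A"
    by (simp add: \<mu>'.emeasure_eq_measure)
  moreover have "(1 - p) * (1 - real n * p) \<le> (1 - p) * measure ?\<mu> A"
    using Suc p by (intro mult_left_mono) auto
  moreover have "1 - real (Suc n) * p \<le> (1 - p) * (1 - real n * p)"
  proof -
    have "0 \<le> real n * (p * p)" by simp
    then show ?thesis by (simp add: algebra_simps)
  qed
  ultimately show ?case by linarith
qed

lemma tv_dist_ge:
  assumes "prob_space \<mu>" "prob_space \<nu>" "A \<in> sets \<mu>"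
  shows "measure \<mu> A - measure \<nu> A \<le> tv_dist \<mu> \<nu>"
proof -
  interpret \<mu>: prob_space \<mu> by fact
  interpret \<nu>: prob_space \<nu> by fact
  have "\<bar>measure \<mu> B - measure \<nu> B\<bar> \<le> 1" for B
    using \<mu>.prob_le_1[of B] \<nu>.prob_le_1[of B] measure_nonneg[of \<mu> B] measure_nonneg[of \<nu> B] by linarith
  then have "bdd_above ((\<lambda>A. \<bar>measure \<mu> A - measure \<nu> A\<bar>) ` sets \<mu>)"
    by (intro bdd_aboveI2)
  from cSUP_upper[OF assms(3) this] show ?thesis
    unfolding tv_dist_def by linarith
qed

text \<open>
  The product coupling, which is the only coupling with a point mass.
\<close>
lemma W2_dirac_le:
  fixes z :: "real \<times> real"
  assumes "prob_space \<pi>" and sets: "sets \<pi> = sets borel" and "0 \<le> c"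
    and le: "(\<integral>\<^sup>+y. ennreal ((dist z y)\<^sup>2) \<partial>\<pi>) \<le> ennreal (c\<^sup>2)"
  shows "W2 (dirac z) \<pi> \<le> ennreal c"
proof -
  interpret \<pi>: prob_space \<pi> by fact
  note [measurable_cong] = sets
  define \<Gamma> where "\<Gamma> = distr \<pi> (borel \<Otimes>\<^sub>M borel) (\<lambda>y. (z, y))"
  have "\<Gamma> \<in> couplings (dirac z) \<pi>"
    unfolding couplings_def
  proof (intro CollectI conjI)
    show "prob_space \<Gamma>" unfolding \<Gamma>_def by (rule \<pi>.prob_space_distr) measurable
    show "sets \<Gamma> = sets (borel \<Otimes>\<^sub>M borel)" by (simp add: \<Gamma>_def)
    show "distr \<Gamma> borel fst = dirac z"
      unfolding \<Gamma>_def dirac_def by (subst distr_distr) (auto simp: o_def)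
    show "distr \<Gamma> borel snd = \<pi>"
      unfolding \<Gamma>_def by (subst distr_distr) (auto simp: o_def distr_id2 sets)
  qed
  moreover have "(\<integral>\<^sup>+ (x, y). ennreal ((dist x y)\<^sup>2) \<partial>\<Gamma>) = (\<integral>\<^sup>+y. ennreal ((dist z y)\<^sup>2) \<partial>\<pi>)"
    unfolding \<Gamma>_def by (subst nn_integral_distr) auto
  ultimately have "(INF \<Gamma>\<in>couplings (dirac z) \<pi>. \<integral>\<^sup>+ (x, y). ennreal ((dist x y)\<^sup>2) \<partial>\<Gamma>) \<le> ennreal (c\<^sup>2)"
    using le by (metis (no_types, lifting) INF_lower2 order_refl)
  then obtain I where I: "0 \<le> I" "I \<le> c\<^sup>2"
    and INF: "(INF \<Gamma>\<in>couplings (dirac z) \<pi>. \<integral>\<^sup>+ (x, y). ennreal ((dist x y)\<^sup>2) \<partial>\<Gamma>) = ennreal I"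
    by (cases "INF \<Gamma>\<in>couplings (dirac z) \<pi>. \<integral>\<^sup>+ (x, y). ennreal ((dist x y)\<^sup>2) \<partial>\<Gamma>")
       (auto simp: top_unique)
  have "sqrt I \<le> c" using I assms(3) by (simp add: real_le_lsqrt)
  then show ?thesis
    unfolding W2_def INF ennreal_sqrt_def using I by (auto intro!: ennreal_leI)
qed

section \<open>Gaussian noise\<close>

lemma std_gaussian_real: "(std_gaussian :: real measure) = density lborel (\<lambda>x. ennreal (std_normal_density x))"
  by (simp add: std_gaussian_def)

lemma sets_std_gaussian [measurable_cong, simp]: "sets (std_gaussian :: real measure) = sets borel"
  by (simp add: std_gaussian_real)

lemma prob_space_std_gaussian: "prob_space (std_gaussian :: real measure)"
  unfolding std_gaussian_real by (rule prob_space_normal_density) simp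

lemma nn_integral_std_gaussian:
  fixes g :: "real \<Rightarrow> ennreal"
  assumes [measurable]: "g \<in> borel_measurable borel"
  shows "(\<integral>\<^sup>+x. g x \<partial>std_gaussian) = (\<integral>\<^sup>+x. ennreal (std_normal_density x) * g x \<partial>lborel)"
  unfolding std_gaussian_real by (rule nn_integral_density) measurable

lemma std_gaussian_second_moment: "(\<integral>\<^sup>+x. ennreal (x\<^sup>2) \<partial>(std_gaussian :: real measure)) = 1"
proof -
  have *: "has_bochner_integral lborel (\<lambda>x::real. std_normal_density x * x\<^sup>2) 1"
    using std_normal_moment_even[of 1] by simp
  have "(\<integral>\<^sup>+x. ennreal (x\<^sup>2) \<partial>(std_gaussian :: real measure))
      = (\<integral>\<^sup>+x. ennreal (std_normal_density x * x\<^sup>2) \<partial>lborel)"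
    by (subst nn_integral_std_gaussian) (auto simp: ennreal_mult)
  also have "\<dots> = ennreal (\<integral>x. std_normal_density x * x\<^sup>2 \<partial>lborel)"
    using * by (intro nn_integral_eq_integral) (auto simp: has_bochner_integral_iff)
  finally show ?thesis using * by (simp add: has_bochner_integral_iff)
qed

text \<open>
  Markov's inequality for \<open>exp (x\<^sup>2 / 4)\<close>, whose product with the standard Gaussian density is
  \<open>\<surd>2\<close> times the Gaussian density of variance \<open>2\<close>.
\<close>
lemma std_gaussian_tail:
  assumes "0 \<le> t"
  shows "emeasure std_gaussian {x::real. t < \<bar>x\<bar>} \<le> ennreal (sqrt 2 * exp (- t\<^sup>2 / 4))"
proof -
  let ?c = "sqrt 2 * exp (- t\<^sup>2 / 4)"
  have pw: "std_normal_density x * indicator {x. t < \<bar>x\<bar>} x \<le> ?c * normal_density 0 (sqrt 2) x" for x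
  proof (cases "t < \<bar>x\<bar>")
    case True
    then have "t\<^sup>2 \<le> x\<^sup>2" using assms by (metis abs_le_square_iff abs_of_nonneg less_imp_le)
    then have "exp (- x\<^sup>2 / 2) \<le> exp (- t\<^sup>2 / 4 + - x\<^sup>2 / 4)"
      by simp
    then have "exp (- x\<^sup>2 / 2) \<le> exp (- t\<^sup>2 / 4) * exp (- x\<^sup>2 / 4)"
      by (simp only: exp_add)
    then have "exp (- x\<^sup>2 / 2) / sqrt (2 * pi) \<le> exp (- t\<^sup>2 / 4) * exp (- x\<^sup>2 / 4) / sqrt (2 * pi)"
      by (intro divide_right_mono) auto
    moreover have "normal_density 0 (sqrt 2) x = exp (- x\<^sup>2 / 4) / (sqrt 2 * sqrt (2 * pi))"
      unfolding normal_density_def by (simp add: real_sqrt_mult mult.assoc[symmetric])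
    then have "exp (- x\<^sup>2 / 4) / sqrt (2 * pi) = sqrt 2 * normal_density 0 (sqrt 2) x"
      by simp
    then have "exp (- t\<^sup>2 / 4) * exp (- x\<^sup>2 / 4) / sqrt (2 * pi) = ?c * normal_density 0 (sqrt 2) x"
      by (simp only: times_divide_eq_right[symmetric] mult_ac)
    ultimately show ?thesis
      using True by (simp add: normal_density_def)
  qed simp
  have "emeasure std_gaussian {x::real. t < \<bar>x\<bar>} = (\<integral>\<^sup>+x. indicator {x. t < \<bar>x\<bar>} x \<partial>(std_gaussian :: real measure))"
    by simp
  also have "\<dots> = (\<integral>\<^sup>+x. ennreal (std_normal_density x * indicator {x. t < \<bar>x\<bar>} x) \<partial>lborel)"
    by (subst nn_integral_std_gaussian) (auto simp: ennreal_mult ennreal_indicator)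
  also have "\<dots> \<le> (\<integral>\<^sup>+x. ennreal (?c * normal_density 0 (sqrt 2) x) \<partial>lborel)"
    by (intro nn_integral_mono ennreal_leI pw)
  also have "\<dots> = ennreal ?c * (\<integral>\<^sup>+x. ennreal (normal_density 0 (sqrt 2) x) \<partial>lborel)"
    by (simp add: ennreal_mult nn_integral_cmult)
  also have "(\<integral>\<^sup>+x. ennreal (normal_density 0 (sqrt 2) x) \<partial>lborel) = 1"
    using prob_space.emeasure_space_1[OF prob_space_normal_density[of "sqrt 2" 0]]
    by (simp add: emeasure_density)
  finally show ?thesis by simp
qed

lemma noise_tail:
  assumes "0 \<le> t"
  shows "measure (std_gaussian \<Otimes>\<^sub>M std_gaussian) {\<xi> :: real \<times> real. t < \<bar>fst \<xi>\<bar> \<or> t < \<bar>snd \<xi>\<bar>}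
    \<le> 2 * (sqrt 2 * exp (- t\<^sup>2 / 4))"
proof -
  let ?N = "std_gaussian \<Otimes>\<^sub>M std_gaussian :: (real \<times> real) measure"
  let ?T = "{x::real. t < \<bar>x\<bar>}"
  interpret G: prob_space "std_gaussian :: real measure" by (rule prob_space_std_gaussian)
  interpret N: prob_space ?N by (intro prob_space_pair prob_space_std_gaussian)
  have sp: "space (std_gaussian :: real measure) = UNIV"
    using sets_eq_imp_space_eq[OF sets_std_gaussian] by simp
  have T: "?T \<in> sets std_gaussian" by simp
  have tail: "measure std_gaussian ?T \<le> sqrt 2 * exp (- t\<^sup>2 / 4)"
    using std_gaussian_tail[OF assms] by (simp add: G.emeasure_eq_measure)
  have U: "UNIV \<in> sets (std_gaussian :: real measure)" by simp
  have mU: "measure std_gaussian (UNIV :: real set) = 1" using G.prob_space sp by simp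
  have times: "measure ?N (A \<times> B) = measure std_gaussian A * measure std_gaussian B"
    if "A \<in> sets std_gaussian" "B \<in> sets std_gaussian" for A B :: "real set"
    using G.emeasure_pair_measure_Times[OF that]
    by (simp add: N.emeasure_eq_measure G.emeasure_eq_measure flip: ennreal_mult)
  have "{\<xi> :: real \<times> real. t < \<bar>fst \<xi>\<bar> \<or> t < \<bar>snd \<xi>\<bar>} = ?T \<times> UNIV \<union> UNIV \<times> ?T" by auto
  also have "measure ?N \<dots> \<le> measure ?N (?T \<times> UNIV) + measure ?N (UNIV \<times> ?T)"
    using T U by (intro measure_Un_le pair_measureI)
  also have "\<dots> \<le> 2 * (sqrt 2 * exp (- t\<^sup>2 / 4))"
    using tail times[OF T U] times[OF U T] mU by simp
  finally show ?thesis .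
qed

text \<open>
  An affine image of a Gaussian has a density that is bounded below on the unit interval, uniformly
  for means in a bounded set.
\<close>
lemma std_gaussian_minorization:
  fixes g :: "real \<Rightarrow> ennreal"
  assumes [measurable]: "g \<in> borel_measurable borel" and c: "0 < c" and m: "\<bar>m\<bar> \<le> B"
  shows "ennreal (std_normal_density ((B + 1) / c) / c) * (\<integral>\<^sup>+y\<in>{0..1}. g y \<partial>lborel)
    \<le> (\<integral>\<^sup>+x. g (m + c * x) \<partial>std_gaussian)"
proof -
  let ?\<kappa> = "std_normal_density ((B + 1) / c)"
  have dens: "?\<kappa> \<le> std_normal_density ((y - m) / c)" if "y \<in> {0..1}" for y
  proof -
    have "\<bar>(y - m) / c\<bar> \<le> \<bar>(B + 1) / c\<bar>"
    proof -
      have "\<bar>y - m\<bar> / c \<le> (B + 1) / c"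
        using that m c by (intro divide_right_mono) auto
      then show ?thesis using m c by (simp add: abs_divide)
    qed
    then have "((y - m) / c)\<^sup>2 \<le> ((B + 1) / c)\<^sup>2"
      by (simp only: abs_le_square_iff)
    then show ?thesis by (simp add: normal_density_def divide_right_mono)
  qed
  have "ennreal ?\<kappa> * (\<integral>\<^sup>+y\<in>{0..1}. g y \<partial>lborel) = (\<integral>\<^sup>+y. ennreal ?\<kappa> * (g y * indicator {0..1} y) \<partial>lborel)"
    by (simp add: nn_integral_cmult)
  also have "\<dots> \<le> (\<integral>\<^sup>+y. ennreal (std_normal_density ((y - m) / c)) * g y \<partial>lborel)"
    using dens by (intro nn_integral_mono) (auto simp: indicator_def intro!: mult_right_mono ennreal_leI)
  also have "\<dots> = ennreal c * (\<integral>\<^sup>+x. ennreal (std_normal_density x) * g (m + c * x) \<partial>lborel)"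
    using c by (subst nn_integral_real_affine[where c = c and t = m]) auto
  also have "\<dots> = ennreal c * (\<integral>\<^sup>+x. g (m + c * x) \<partial>std_gaussian)"
    by (subst nn_integral_std_gaussian) auto
  finally have *: "ennreal ?\<kappa> * (\<integral>\<^sup>+y\<in>{0..1}. g y \<partial>lborel) \<le> ennreal c * (\<integral>\<^sup>+x. g (m + c * x) \<partial>std_gaussian)" .
  have "ennreal (?\<kappa> / c) * (\<integral>\<^sup>+y\<in>{0..1}. g y \<partial>lborel) = ennreal (1 / c) * (ennreal ?\<kappa> * (\<integral>\<^sup>+y\<in>{0..1}. g y \<partial>lborel))"
    using c by (simp add: mult.assoc[symmetric] ennreal_mult[symmetric])
  also have "\<dots> \<le> ennreal (1 / c) * (ennreal c * (\<integral>\<^sup>+x. g (m + c * x) \<partial>std_gaussian))"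
    by (intro mult_left_mono *) simp
  also have "\<dots> = (\<integral>\<^sup>+x. g (m + c * x) \<partial>std_gaussian)"
    using c by (simp add: mult.assoc[symmetric] ennreal_mult[symmetric])
  finally show ?thesis .
qed

section \<open>One step in position-lag coordinates\<close>

lemma h_star_pos: "0 < h_star" and h_star_sq: "h_star * h_star = 2 / 13"
  by (simp_all add: h_star_def)

lemma friction_star: "exp (- gamma_star * h_star / 2) = 2 / 3"
proof -
  have "ln (4 / 9) = ln ((2 / 3 :: real)\<^sup>2)" by (simp add: power2_eq_square)
  also have "\<dots> = 2 * ln (2 / 3)" by (subst ln_realpow) auto
  finally have "- gamma_star * h_star / 2 = ln (2 / 3)"
    using h_star_pos by (simp add: gamma_star_def beta_star_def)
  then show ?thesis by simp
qed

lemma grad_real: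
  assumes "(U has_real_derivative D) (at x)"
  shows "grad U x = D"
proof -
  have "GDERIV U x :> d \<longleftrightarrow> (U has_real_derivative d) (at x)" for d
    by (simp add: gderiv_def has_field_derivative_def mult.commute[of d])
  then show ?thesis
    unfolding grad_def using assms DERIV_unique by (intro the_equality) blast+
qed

text \<open>
  For the potential \<open>25 x\<^sup>2 / 2\<close> the mean of the next position is \<open>-(12/13) x + (2/3) h v\<close>, and adding \<open>2/3 x\<close>
  gives this expression. It turns the step into a Jordan block with eigenvalue \<open>-2/3\<close>.
\<close>
definition lag :: "real \<times> real \<Rightarrow> real" where
  "lag z = 2 / 3 * h_star * snd z - 10 / 39 * fst z"

text \<open>
  The standard deviation of the next position given the current state.
\<close>
definition noise_scale :: real where
  "noise_scale = h_star * (sqrt 5 / 3)"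

text \<open>
  With \<open>h\<^sup>2 = 2/13\<close> and \<open>r = 2/3\<close>, the new lag is an affine function of the two positions
  alone, namely \<open>-2/3 (x' + 2/3 x)\<close>, apart from the contributions of \<open>G x'\<close> and of the second noise.
\<close>
lemma obabo_step_coordinates:
  fixes U F G :: "real \<Rightarrow> real"
  assumes dU: "\<And>x. (U has_real_derivative F x) (at x)" and G: "\<And>x. F x = 25 * x + G x"
  defines "step \<equiv> obabo_step h_star gamma_star U"
  shows "fst (step z (a, b)) = - (2/3) * fst z + lag z + noise_scale * a - G (fst z) / 13"
    and "lag (step z (a, b)) = - (2/3) * (lag z + noise_scale * a - G (fst z) / 13)
      - 4/117 * G (fst (step z (a, b))) + 2/3 * noise_scale * b"
proof -
  obtain x v where z: "z = (x, v)" by (cases z)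
  then have fz: "fst z = x" by simp
  define vb where "vb = 2/3 * v + sqrt 5 / 3 * a - h_star / 2 * F x"
  define x' where "x' = x + h_star * vb"
  have sqrt_beta: "sqrt (1 - (2/3)\<^sup>2) = sqrt 5 / (3::real)"
  proof -
    have "(sqrt 5 / 3)\<^sup>2 = 1 - (2/3 :: real)\<^sup>2" by (simp add: power_divide)
    then show ?thesis by (rule real_sqrt_unique) simp
  qed
  have step: "step z (a, b) = (x', 2/3 * (vb - h_star / 2 * F x') + sqrt 5 / 3 * b)"
    unfolding step_def obabo_step_def z friction_star Let_def split real_scaleR_def
      grad_real[OF dU] sqrt_beta
    by (simp add: x'_def vb_def)
  have hh: "h_star * (h_star * t) = 2/13 * t" for t
    by (simp only: mult.assoc[symmetric] h_star_sq)
  have "x' = x + 2/3 * (h_star * v) + noise_scale * a - h_star * (h_star * F x) / 2"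
    by (simp add: x'_def vb_def noise_scale_def algebra_simps)
  then have "x' = x + 2/3 * (h_star * v) + noise_scale * a - F x / 13"
    by (simp add: hh)
  moreover have lag_z: "lag z = 2/3 * (h_star * v) - 10/39 * x"
    by (simp add: lag_def z)
  ultimately have x': "x' = - (2/3) * x + lag z + noise_scale * a - G x / 13"
    using G[of x] by linarith
  then show "fst (step z (a, b)) = - (2/3) * fst z + lag z + noise_scale * a - G (fst z) / 13"
    by (simp only: step fst_conv fz)
  have hvb: "h_star * vb = x' - x" by (simp add: x'_def)
  have expand: "e * (2/3 * (p - e / 2 * f) + s / 3 * c) = 2/3 * (e * p) - (e * (e * f)) / 3 + e * (s / 3) * c"
    for e p f s c :: real
    by (simp add: algebra_simps)
  have "lag (step z (a, b)) = 2/3 * (h_star * (2/3 * (vb - h_star / 2 * F x') + sqrt 5 / 3 * b)) - 10/39 * x'"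
    by (simp only: step lag_def fst_conv snd_conv mult.assoc)
  also have "\<dots> = 2/3 * (2/3 * (x' - x) - (2/13 * F x') / 3 + noise_scale * b) - 10/39 * x'"
    by (simp only: expand hh hvb noise_scale_def)
  also have "\<dots> = - (2/3) * (x' + 2/3 * x) - 4/117 * G x' + 2/3 * noise_scale * b"
    by (simp add: G algebra_simps add_divide_distrib diff_divide_distrib)
  finally have L: "lag (step z (a, b)) = - (2/3) * (x' + 2/3 * x) - 4/117 * G x' + 2/3 * noise_scale * b" .
  have fst_step: "fst (step z (a, b)) = x'"
    by (simp only: step fst_conv)
  show "lag (step z (a, b)) = - (2/3) * (lag z + noise_scale * a - G (fst z) / 13)
      - 4/117 * G (fst (step z (a, b))) + 2/3 * noise_scale * b"
  proof -
    have "x' + 2/3 * x = lag z + noise_scale * a - G x / 13" using x' by linarith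
    then show ?thesis unfolding fst_step fz L by (simp only:)
  qed
qed

lemma noise_scale_bounds: "0 < noise_scale" "noise_scale \<le> 3/10"
proof -
  have "noise_scale\<^sup>2 = h_star * h_star * (5 / 9)"
    by (simp add: noise_scale_def power2_eq_square)
  also have "\<dots> \<le> (3/10)\<^sup>2"
    by (simp add: h_star_sq power2_eq_square)
  finally show "noise_scale \<le> 3/10"
    by (rule power2_le_imp_le) simp
qed (simp add: noise_scale_def h_star_pos)

section \<open>The invariant law\<close>

text \<open>
  The weight \<open>100\<close> makes the off-diagonal entry of the Jordan block small compared with its diagonal,
  so that \<open>x\<^sup>2 + 100 s\<^sup>2\<close> is a Lyapunov function; \<open>p\<close> and \<open>q\<close> collect perturbation and noise.
\<close>
lemma jordan_block_decay:
  fixes x s p q :: real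
  shows "(- (2/3) * x + s + p)\<^sup>2 + 100 * (- (2/3) * s + q)\<^sup>2
    \<le> 2/3 * (x\<^sup>2 + 100 * s\<^sup>2) + 10 * p\<^sup>2 + 500 * q\<^sup>2"
proof -
  have young: "(u + w)\<^sup>2 \<le> 5/4 * u\<^sup>2 + 5 * w\<^sup>2" for u w :: real
    using zero_le_power2[of "u / 2 - 2 * w"] by (simp add: power2_eq_square algebra_simps)
  have "(- (2/3) * x + s + p)\<^sup>2 \<le> 5/9 * x\<^sup>2 + 5 * (s + p)\<^sup>2"
    using young[of "- (2/3) * x" "s + p"] by (simp add: power2_eq_square algebra_simps)
  moreover have "(s + p)\<^sup>2 \<le> 2 * s\<^sup>2 + 2 * p\<^sup>2"
    using zero_le_power2[of "s - p"] by (simp add: power2_eq_square algebra_simps)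
  moreover have "(- (2/3) * s + q)\<^sup>2 \<le> 5/9 * s\<^sup>2 + 5 * q\<^sup>2"
    using young[of "- (2/3) * s" q] by (simp add: power2_eq_square algebra_simps)
  moreover have "0 \<le> x\<^sup>2" "0 \<le> s\<^sup>2" by simp_all
  moreover have "2/3 * (x\<^sup>2 + 100 * s\<^sup>2) = 2/3 * x\<^sup>2 + 200/3 * s\<^sup>2"
    by (simp add: algebra_simps)
  ultimately show ?thesis by linarith
qed

lemma sq_abs_le: "\<bar>x\<bar> \<le> y \<Longrightarrow> x\<^sup>2 \<le> y\<^sup>2" for x y :: real
  using abs_le_square_iff[of x y] by simp

text \<open>
  Forces that differ from the linear force \<open>25 x\<close> by a bounded amount. The bound scales with \<open>R\<close>, as it does
  for the rescaled potential, and \<open>R \<ge> 1\<close> lets the unit variance of the noise be absorbed into \<open>R\<^sup>2\<close>.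
\<close>
locale bounded_perturbation =
  fixes U F G :: "real \<Rightarrow> real" and R :: real
  assumes dU: "\<And>x. (U has_real_derivative F x) (at x)"
    and F_eq: "\<And>x. F x = 25 * x + G x"
    and G_measurable [measurable]: "G \<in> borel_measurable borel"
    and G_bound: "\<And>x. \<bar>G x\<bar> \<le> 25 * R"
    and R_ge_1: "1 \<le> R"
begin

abbreviation Q :: "real \<times> real \<Rightarrow> (real \<times> real) measure" where
  "Q \<equiv> obabo_kernel h_star gamma_star U"

abbreviation step :: "real \<times> real \<Rightarrow> real \<times> real \<Rightarrow> real \<times> real" where
  "step \<equiv> obabo_step h_star gamma_star U"

lemmas step_coordinates = obabo_step_coordinates[OF dU F_eq]

lemma F_measurable [measurable]: "F \<in> borel_measurable borel"
proof -
  have "F = (\<lambda>x. 25 * x + G x)" using F_eq by blast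
  then show ?thesis by simp
qed

lemma step_measurable: "case_prod step \<in> borel \<Otimes>\<^sub>M (std_gaussian \<Otimes>\<^sub>M std_gaussian) \<rightarrow>\<^sub>M borel"
proof -
  have "case_prod step \<in> (borel \<Otimes>\<^sub>M borel) \<Otimes>\<^sub>M (std_gaussian \<Otimes>\<^sub>M std_gaussian) \<rightarrow>\<^sub>M borel \<Otimes>\<^sub>M borel"
    unfolding obabo_step_def Let_def grad_real[OF dU] real_scaleR_def case_prod_beta by measurable
  then show ?thesis by (simp only: borel_prod)
qed

lemma step_measurable_noise [measurable]: "step z \<in> std_gaussian \<Otimes>\<^sub>M std_gaussian \<rightarrow>\<^sub>M borel"
  using measurable_compose[OF measurable_Pair1' step_measurable, of z] by simp

lemma prob_space_noise: "prob_space (std_gaussian \<Otimes>\<^sub>M std_gaussian :: (real \<times> real) measure)"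
  by (intro prob_space_pair prob_space_std_gaussian)

lemma Q_prob: "prob_space (Q z)"
  unfolding obabo_kernel_def by (intro prob_space.prob_space_distr prob_space_noise) measurable

lemma Q_sets [simp]: "sets (Q z) = sets borel"
  by (simp add: obabo_kernel_def)

lemma Q_kernel: "Q \<in> borel \<rightarrow>\<^sub>M subprob_algebra borel"
  unfolding obabo_kernel_def[abs_def]
proof (rule measurable_distr2[OF step_measurable])
  show "(\<lambda>z. std_gaussian \<Otimes>\<^sub>M std_gaussian :: (real \<times> real) measure) \<in> (borel :: (real \<times> real) measure) \<rightarrow>\<^sub>M subprob_algebra (std_gaussian \<Otimes>\<^sub>M std_gaussian)"
    by (intro measurable_const)
       (simp add: space_subprob_algebra, rule prob_space_imp_subprob_space[OF prob_space_noise])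
qed

lemma nn_integral_Q:
  assumes [measurable]: "f \<in> borel_measurable borel"
  shows "(\<integral>\<^sup>+y. f y \<partial>Q z) = (\<integral>\<^sup>+a. \<integral>\<^sup>+b. f (step z (a, b)) \<partial>std_gaussian \<partial>std_gaussian)"
proof -
  interpret G: prob_space "std_gaussian :: real measure" by (rule prob_space_std_gaussian)
  have "(\<integral>\<^sup>+y. f y \<partial>Q z) = (\<integral>\<^sup>+\<xi>. f (step z \<xi>) \<partial>(std_gaussian \<Otimes>\<^sub>M std_gaussian))"
    unfolding obabo_kernel_def by (rule nn_integral_distr) measurable
  then show ?thesis
    by (subst (asm) G.nn_integral_fst[symmetric]) auto
qed

definition V :: "real \<times> real \<Rightarrow> real" where
  "V z = (fst z)\<^sup>2 + 100 * (lag z)\<^sup>2"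

lemma V_measurable [measurable]: "V \<in> borel_measurable borel"
  unfolding V_def[abs_def] lag_def by (intro borel_measurable_continuous_onI continuous_intros)

lemma V_nonneg: "0 \<le> V z"
  by (simp add: V_def)

lemma V_step: "V (step z (a, b)) \<le> 2/3 * V z + 10000 * (R\<^sup>2 + a\<^sup>2 + b\<^sup>2)"
proof -
  define p where "p = noise_scale * a - G (fst z) / 13"
  define q where "q = - (2/3) * p - 4/117 * G (fst (step z (a, b))) + 2/3 * noise_scale * b"
  have fst': "fst (step z (a, b)) = - (2/3) * fst z + lag z + p"
    by (subst step_coordinates(1)) (simp add: p_def)
  have lag': "lag (step z (a, b)) = - (2/3) * lag z + q"
    unfolding q_def p_def by (subst step_coordinates(2)) (simp add: algebra_simps)
  have noise_scale: "\<bar>noise_scale * t\<bar> \<le> 3/10 * \<bar>t\<bar>" for t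
    using mult_right_mono[OF noise_scale_bounds(2), of "\<bar>t\<bar>"] noise_scale_bounds(1) by (simp add: abs_mult)
  have sq3: "(u + v + w)\<^sup>2 \<le> 3 * (u\<^sup>2 + v\<^sup>2 + w\<^sup>2)" for u v w :: real
    using zero_le_power2[of "u - v"] zero_le_power2[of "u - w"] zero_le_power2[of "v - w"]
    by (simp add: power2_eq_square algebra_simps)
  have "\<bar>p\<bar> \<le> 3/10 * \<bar>a\<bar> + 2 * R"
    using noise_scale[of a] G_bound[of "fst z"] R_ge_1 unfolding p_def by linarith
  then have "p\<^sup>2 \<le> (3/10 * \<bar>a\<bar> + 2 * R)\<^sup>2" by (rule sq_abs_le)
  also have "\<dots> \<le> 3 * ((3/10 * \<bar>a\<bar>)\<^sup>2 + (2 * R)\<^sup>2 + 0\<^sup>2)"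
    using sq3[of "3/10 * \<bar>a\<bar>" "2 * R" 0] by simp
  also have "\<dots> = 27/100 * a\<^sup>2 + 12 * R\<^sup>2"
    by (simp add: power_mult_distrib power_divide)
  finally have p: "p\<^sup>2 \<le> 27/100 * a\<^sup>2 + 12 * R\<^sup>2" .
  have "\<bar>q\<bar> \<le> 2/3 * \<bar>p\<bar> + R + 1/5 * \<bar>b\<bar>"
    using noise_scale[of b] G_bound[of "fst (step z (a, b))"] R_ge_1 unfolding q_def by linarith
  then have "q\<^sup>2 \<le> (2/3 * \<bar>p\<bar> + R + 1/5 * \<bar>b\<bar>)\<^sup>2" by (rule sq_abs_le)
  also have "\<dots> \<le> 3 * ((2/3 * \<bar>p\<bar>)\<^sup>2 + R\<^sup>2 + (1/5 * \<bar>b\<bar>)\<^sup>2)" by (rule sq3)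
  also have "\<dots> = 4/3 * p\<^sup>2 + 3 * R\<^sup>2 + 3/25 * b\<^sup>2"
    by (simp add: power_mult_distrib power_divide)
  finally have q: "q\<^sup>2 \<le> 4/3 * p\<^sup>2 + 3 * R\<^sup>2 + 3/25 * b\<^sup>2" .
  have "V (step z (a, b)) \<le> 2/3 * V z + 10 * p\<^sup>2 + 500 * q\<^sup>2"
    using jordan_block_decay[of "fst z" "lag z" p q] unfolding V_def fst' lag' .
  (* the coefficient of R^2 is 10 * 12 + 500 * (4/3 * 12 + 3) = 9620 *)
  moreover have "10 * p\<^sup>2 + 500 * q\<^sup>2 \<le> 10000 * R\<^sup>2 + 10000 * a\<^sup>2 + 10000 * b\<^sup>2"
    using p q zero_le_power2[of a] zero_le_power2[of b] zero_le_power2[of R]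
    by linarith
  ultimately show ?thesis by (simp add: distrib_left)
qed

lemma drift: "(\<integral>\<^sup>+y. V y \<partial>Q z) \<le> ennreal (2/3 * V z + 30000 * R\<^sup>2)"
proof -
  interpret G: prob_space "std_gaussian :: real measure" by (rule prob_space_std_gaussian)
  have [simp]: "emeasure std_gaussian (UNIV :: real set) = 1"
    using G.emeasure_space_1 sets_eq_imp_space_eq[OF sets_std_gaussian] by simp
  have [simp]: "space (std_gaussian :: real measure) = UNIV"
    using sets_eq_imp_space_eq[OF sets_std_gaussian] by simp
  let ?c = "2/3 * V z + 10000 * R\<^sup>2"
  have c: "0 \<le> ?c" using V_nonneg[of z] by simp
  have "(\<integral>\<^sup>+y. V y \<partial>Q z) = (\<integral>\<^sup>+a. \<integral>\<^sup>+b. V (step z (a, b)) \<partial>std_gaussian \<partial>std_gaussian)"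
    by (rule nn_integral_Q) measurable
  also have "\<dots> \<le> (\<integral>\<^sup>+a. \<integral>\<^sup>+b. (ennreal ?c + 10000 * ennreal (a\<^sup>2)) + 10000 * ennreal (b\<^sup>2) \<partial>std_gaussian \<partial>std_gaussian)"
  proof (intro nn_integral_mono)
    fix a b :: real
    have "ennreal (V (step z (a, b))) \<le> ennreal (?c + 10000 * a\<^sup>2 + 10000 * b\<^sup>2)"
      using V_step[of z a b] by (intro ennreal_leI) (simp add: algebra_simps)
    also have "\<dots> = (ennreal ?c + 10000 * ennreal (a\<^sup>2)) + 10000 * ennreal (b\<^sup>2)"
      using c by (simp add: ennreal_plus ennreal_mult' del: ennreal_plus[symmetric])
    finally show "ennreal (V (step z (a, b))) \<le> \<dots>" .
  qed
  also have "\<dots> = (\<integral>\<^sup>+a. ennreal ?c + 10000 * ennreal (a\<^sup>2) + 10000 \<partial>std_gaussian)"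
    by (intro nn_integral_cong, subst nn_integral_add)
       (auto simp: nn_integral_cmult std_gaussian_second_moment)
  also have "\<dots> = ennreal ?c + 10000 + 10000"
    by (subst nn_integral_add, simp, simp, subst nn_integral_add)
       (auto simp: nn_integral_cmult std_gaussian_second_moment)
  also have "\<dots> = ennreal (?c + 10000 + 10000)"
    using c by simp
  also have "\<dots> \<le> ennreal (2/3 * V z + 30000 * R\<^sup>2)"
  proof -
    have "1 \<le> R\<^sup>2" using R_ge_1 by (simp add: one_le_power)
    then show ?thesis by (intro ennreal_leI) simp
  qed
  finally show ?thesis .
qed

definition unit_square :: "(real \<times> real) measure" where
  "unit_square = uniform_measure lborel {0..1} \<Otimes>\<^sub>M uniform_measure lborel {0..1}"

lemma prob_space_unit: "prob_space (uniform_measure lborel {0..1::real})"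
  by (rule prob_space_uniform_measure) auto

lemma prob_space_unit_square: "prob_space unit_square"
  unfolding unit_square_def by (intro prob_space_pair prob_space_unit)

lemma sets_unit_square: "sets unit_square = sets borel"
proof -
  have "sets unit_square = sets (borel \<Otimes>\<^sub>M borel)"
    unfolding unit_square_def by (intro sets_pair_measure_cong) auto
  then show ?thesis by (simp only: borel_prod)
qed

lemma emeasure_unit_square:
  assumes "A \<in> sets borel"
  shows "emeasure unit_square A = (\<integral>\<^sup>+x\<in>{0..1}. (\<integral>\<^sup>+y\<in>{0..1}. indicator A (x, y) \<partial>lborel) \<partial>lborel)"
proof -
  interpret prob_space "uniform_measure lborel {0..1::real}" by (rule prob_space_unit)
  have A [measurable]: "A \<in> sets (borel \<Otimes>\<^sub>M borel)" using assms by (simp only: borel_prod)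
  have A': "A \<in> sets unit_square" using assms by (simp add: sets_unit_square)
  have "emeasure unit_square A
      = (\<integral>\<^sup>+x. \<integral>\<^sup>+y. indicator A (x, y) \<partial>uniform_measure lborel {0..1} \<partial>uniform_measure lborel {0..1})"
    using A' unfolding unit_square_def by (rule emeasure_pair_measure)
  also have "\<dots> = (\<integral>\<^sup>+x. (\<integral>\<^sup>+y\<in>{0..1}. indicator A (x, y) \<partial>lborel) \<partial>uniform_measure lborel {0..1})"
    by (intro nn_integral_cong, subst nn_integral_uniform_measure) (auto simp: divide_ennreal_def)
  also have "\<dots> = (\<integral>\<^sup>+x\<in>{0..1}. (\<integral>\<^sup>+y\<in>{0..1}. indicator A (x, y) \<partial>lborel) \<partial>lborel)"
    by (subst nn_integral_uniform_measure) (auto simp: divide_ennreal_def)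
  finally show ?thesis .
qed

text \<open>
  Given \<open>z\<close>, the new position is an affine function of the first noise, and given both positions the new
  velocity is an affine function of the second noise. On a sublevel set of \<open>V\<close>, and for new positions in
  the unit interval, the means of both are bounded, so the Gaussian bound can be used twice.
\<close>
lemma minorization:
  "\<exists>\<epsilon>>0. \<epsilon> \<le> 1 \<and> (\<forall>z A. V z \<le> M \<longrightarrow> A \<in> sets borel \<longrightarrow>
    ennreal \<epsilon> * emeasure unit_square A \<le> emeasure (Q z) A)"
proof -
  (* the mean of the new position, and of the new velocity given both positions *)
  define m where "m z = - (2/3) * fst z + lag z - G (fst z) / 13" for z
  define m' where "m' x x' = 3 / (2 * h_star) * (- (16/39) * x' - 4/9 * x - 4/117 * G x')" for x x'
  define S where "S = sqrt \<bar>M\<bar>"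
  define c where "c = sqrt 5 / (3::real)"
  have c: "0 < c" by (simp add: c_def)
  have step: "step z (a, b) = (m z + noise_scale * a, m' (fst z) (m z + noise_scale * a) + c * b)" for z a b
  proof -
    let ?z' = "step z (a, b)"
    have 1: "fst ?z' = m z + noise_scale * a"
      by (subst step_coordinates(1)) (simp add: m_def)
    have "lag ?z' = - (2/3) * (fst ?z' + 2/3 * fst z) - 4/117 * G (fst ?z') + 2/3 * (h_star * c * b)"
      using step_coordinates[of z a b] by (simp add: noise_scale_def c_def algebra_simps)
    then have "2/3 * h_star * snd ?z' = - (16/39) * fst ?z' - 4/9 * fst z - 4/117 * G (fst ?z') + 2/3 * h_star * (c * b)"
      unfolding lag_def by (simp add: algebra_simps)
    then have "snd ?z' = m' (fst z) (fst ?z') + c * b"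
      using h_star_pos unfolding m'_def by (simp add: field_simps)
    with 1 show ?thesis by (metis prod.collapse)
  qed
  define B where "B = 2 * S + 2 * R"
  define B' where "B' = 3 / (2 * h_star) * (1 + S + R)"
  define \<kappa> where "\<kappa> = std_normal_density ((B + 1) / noise_scale) / noise_scale"
  define \<kappa>' where "\<kappa>' = std_normal_density ((B' + 1) / c) / c"
  have \<kappa>: "0 < \<kappa>" "0 < \<kappa>'"
    using noise_scale_bounds c by (simp_all add: \<kappa>_def \<kappa>'_def normal_density_pos)
  have "ennreal (min 1 (\<kappa> * \<kappa>')) * emeasure unit_square A \<le> emeasure (Q z) A"
    if Vz: "V z \<le> M" and A: "A \<in> sets borel" for z A
  proof -
    have A_pair [measurable]: "A \<in> sets (borel \<Otimes>\<^sub>M borel)" using A by (simp only: borel_prod)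
    have "(fst z)\<^sup>2 \<le> \<bar>M\<bar>" "(lag z)\<^sup>2 \<le> \<bar>M\<bar>"
      using Vz zero_le_power2[of "fst z"] zero_le_power2[of "lag z"] unfolding V_def by linarith+
    then have x: "\<bar>fst z\<bar> \<le> S" and s: "\<bar>lag z\<bar> \<le> S"
      unfolding S_def by (simp_all add: real_le_rsqrt)
    have mB: "\<bar>m z\<bar> \<le> B"
      using x s G_bound[of "fst z"] R_ge_1 unfolding m_def B_def by linarith
    have mB': "\<bar>m' (fst z) x'\<bar> \<le> B'" if "x' \<in> {0..1}" for x'
    proof -
      have "\<bar>- (16/39) * x' - 4/9 * fst z - 4/117 * G x'\<bar> \<le> 1 + S + R"
        using that x G_bound[of x'] R_ge_1 by (auto simp: abs_le_iff)
      then show ?thesis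
        using h_star_pos unfolding m'_def B'_def by (simp add: abs_mult mult_left_mono divide_right_mono)
    qed
    have m'_meas [measurable]: "(\<lambda>x'. m' (fst z) x') \<in> borel_measurable borel"
      unfolding m'_def by measurable
    interpret G: prob_space "std_gaussian :: real measure" by (rule prob_space_std_gaussian)
    define H where "H x' = (\<integral>\<^sup>+b. indicator A (x', m' (fst z) x' + c * b) \<partial>std_gaussian)" for x'
    have [measurable]: "H \<in> borel_measurable borel"
      unfolding H_def by measurable
    have "ennreal (min 1 (\<kappa> * \<kappa>')) * emeasure unit_square A \<le> ennreal (\<kappa> * \<kappa>') * emeasure unit_square A"
      by (intro mult_right_mono ennreal_leI) auto
    also have "\<dots> = ennreal \<kappa> * (\<integral>\<^sup>+x'\<in>{0..1}. (ennreal \<kappa>' * (\<integral>\<^sup>+y\<in>{0..1}. indicator A (x', y) \<partial>lborel)) \<partial>lborel)"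
      unfolding emeasure_unit_square[OF A] using \<kappa>
      by (simp add: ennreal_mult mult.assoc nn_integral_cmult)
    also have "\<dots> \<le> ennreal \<kappa> * (\<integral>\<^sup>+x'\<in>{0..1}. H x' \<partial>lborel)"
    proof (intro mult_left_mono nn_integral_mono)
      fix x' :: real
      have "ennreal \<kappa>' * (\<integral>\<^sup>+y\<in>{0..1}. indicator A (x', y) \<partial>lborel) \<le> H x'" if "x' \<in> {0..1}"
        unfolding \<kappa>'_def H_def
        by (rule std_gaussian_minorization[where g = "\<lambda>y. indicator A (x', y)", OF _ c mB'[OF that]]) measurable
      then show "ennreal \<kappa>' * (\<integral>\<^sup>+y\<in>{0..1}. indicator A (x', y) \<partial>lborel) * indicator {0..1} x' \<le> H x' * indicator {0..1} x'"
        by (auto simp: indicator_def)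
    qed simp
    also have "\<dots> \<le> (\<integral>\<^sup>+a. H (m z + noise_scale * a) \<partial>std_gaussian)"
      unfolding \<kappa>_def by (rule std_gaussian_minorization[OF _ noise_scale_bounds(1) mB]) measurable
    also have "\<dots> = (\<integral>\<^sup>+y. indicator A y \<partial>Q z)"
      using A by (subst nn_integral_Q) (auto simp: H_def step)
    also have "\<dots> = emeasure (Q z) A"
      using A by simp
    finally show ?thesis .
  qed
  then show ?thesis
    using \<kappa> by (intro exI[of _ "min 1 (\<kappa> * \<kappa>')"]) auto
qed

text \<open>
  The order \<open>R\<^sup>2\<close> of the moment is what makes the Wasserstein bound proportional to \<open>R\<close>.
\<close>
theorem invariant_law_second_moment:
  "\<exists>\<pi>. invariant_law Q \<pi> \<and> (\<forall>\<pi>'. invariant_law Q \<pi>' \<longrightarrow> \<pi>' = \<pi>)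
    \<and> (\<integral>\<^sup>+y. V y \<partial>\<pi>) \<le> ennreal (90000 * R\<^sup>2)"
proof -
  let ?K = "30000 * R\<^sup>2"
  have K: "0 < ?K" using R_ge_1 by simp
  obtain \<epsilon> where \<epsilon>: "0 < \<epsilon>" "\<epsilon> \<le> 1"
    and minor: "\<And>z A. V z \<le> 12 * ?K \<Longrightarrow> A \<in> sets borel \<Longrightarrow>
      ennreal \<epsilon> * emeasure unit_square A \<le> emeasure (Q z) A"
    using minorization[of "12 * ?K"] by blast
  have "V (0, 0) \<le> 12 * ?K" using R_ge_1 by (simp add: V_def lag_def)
  have \<rho>: "0 \<le> (2/3 :: real)" "2/3 < (1 :: real)" by simp_all
  have M: "4 * ?K / (1 - 2/3) \<le> 12 * ?K" by simp
  have "90000 * R\<^sup>2 = ?K / (1 - 2/3)" by simp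
  then show ?thesis
    using harris_invariant_law[OF Q_kernel Q_prob prob_space_unit_square sets_unit_square
        V_measurable V_nonneg \<rho> K drift M \<epsilon> minor \<open>V (0, 0) \<le> 12 * ?K\<close>]
    by (simp only:)
qed

end

section \<open>Tubes around the fixed point and the cycle\<close>

text \<open>
  Boxes in the coordinates of the Jordan block. With noise at most \<open>R/100\<close> and \<open>G\<close> within \<open>3/250 R\<close> of
  its nominal value, the half widths have to satisfy, up to these small errors in \<open>G\<close>,
  \<open>2/3 (9/200 + 1/100) + 2/3 1/100 \<le> 9/200\<close> and \<open>2/3 9/50 + 9/200 + 1/100 \<le> 9/50\<close>.
\<close>
definition tube :: "real \<Rightarrow> real \<times> real \<Rightarrow> (real \<times> real) set" where
  "tube R c = {z. \<bar>fst z - fst c * R\<bar> \<le> 9/50 * R \<and> \<bar>lag z - snd c * R\<bar> \<le> 9/200 * R}"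

lemma tube_closed: "closed (tube R c)"
  unfolding tube_def lag_def
  by (intro closed_Collect_conj closed_Collect_le continuous_intros)

lemma tube_measurable [measurable]: "tube R c \<in> sets borel"
  by (rule borel_closed[OF tube_closed])

locale scaled_force = bounded_perturbation +
  assumes G_left: "\<And>x. x \<le> 22/25 * R \<Longrightarrow> \<bar>G x\<bar> \<le> 3/250 * R"
    and G_right: "\<And>x. 47/25 * R \<le> x \<Longrightarrow> \<bar>G x + 24 * R\<bar> \<le> 3/250 * R"
begin

lemma step_fst_tube:
  assumes z: "z \<in> tube R (x, s)" and xi: "\<bar>a\<bar> \<le> R / 30"
    and g: "\<bar>G (fst z) - g * R\<bar> \<le> 3/250 * R" and x': "x' = - (2/3) * x + s - g / 13"
  shows "\<bar>fst (step z (a, b)) - x' * R\<bar> \<le> 9/50 * R"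
proof -
  have n: "\<bar>noise_scale * a\<bar> \<le> R / 100"
    using mult_mono[OF noise_scale_bounds(2) xi] noise_scale_bounds(1) by (simp add: abs_mult)
  have "x' * R = - (2/3) * (x * R) + s * R - g * R / 13"
    unfolding x' by (simp add: algebra_simps)
  moreover have "\<bar>fst z - x * R\<bar> \<le> 9/50 * R" "\<bar>lag z - s * R\<bar> \<le> 9/200 * R"
    using z by (simp_all add: tube_def)
  ultimately show ?thesis
    using g n R_ge_1 unfolding step_coordinates(1) by linarith
qed

text \<open>
  Here \<open>g R\<close> and \<open>g' R\<close> are the nominal values of \<open>G\<close> at the old and the new position, so that \<open>(x', s')\<close> is
  the image of the centre \<open>(x, s)\<close> under the noiseless map of the piecewise quadratic potential.
\<close>
lemma step_tube:
  assumes z: "z \<in> tube R (x, s)" and a: "\<bar>a\<bar> \<le> R / 30" and b: "\<bar>b\<bar> \<le> R / 30"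
    and g: "\<bar>G (fst z) - g * R\<bar> \<le> 3/250 * R" and x': "x' = - (2/3) * x + s - g / 13"
    and g': "\<bar>G (fst (step z (a, b))) - g' * R\<bar> \<le> 3/250 * R"
    and s': "s' = - (2/3) * (s - g / 13) - 4/117 * g'"
  shows "step z (a, b) \<in> tube R (x', s')"
proof -
  have na: "\<bar>noise_scale * a\<bar> \<le> R / 100"
    using mult_mono[OF noise_scale_bounds(2) a] noise_scale_bounds(1) by (simp add: abs_mult)
  have nb: "\<bar>noise_scale * b\<bar> \<le> R / 100"
    using mult_mono[OF noise_scale_bounds(2) b] noise_scale_bounds(1) by (simp add: abs_mult)
  have s'R: "s' * R = - (2/3) * (s * R) + 2/39 * (g * R) - 4/117 * (g' * R)"
    unfolding s' by (simp add: algebra_simps)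
  have lag': "lag (step z (a, b)) = - (2/3) * lag z - 2/3 * (noise_scale * a) + 2/39 * G (fst z)
      - 4/117 * G (fst (step z (a, b))) + 2/3 * (noise_scale * b)"
    unfolding step_coordinates(2)[of z a b] by (simp add: algebra_simps)
  have "\<bar>lag z - s * R\<bar> \<le> 9/200 * R" using z by (simp add: tube_def)
  then have "\<bar>lag (step z (a, b)) - s' * R\<bar> \<le> 9/200 * R"
    using g g' na nb R_ge_1 unfolding lag' s'R by linarith
  then show ?thesis
    using step_fst_tube[OF z a g x'] by (simp add: tube_def)
qed

definition rest_region :: "(real \<times> real) set" where
  "rest_region = tube R (0, 0)"

text \<open>
  The lag coordinates follow from the positions of the cycle:
  \<open>s\<^sub>n = x\<^sub>n\<^sub>+\<^sub>1 + 2/3 x\<^sub>n + g\<^sub>n / 13\<close>, with \<open>g\<^sub>n = -24\<close> at \<open>2592/1225\<close> and \<open>g\<^sub>n = 0\<close> at the other two points.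
\<close>
definition cycle_region :: "(real \<times> real) set" where
  "cycle_region = tube R (2592/1225, 96/455) \<union> tube R (792/1225, - 48/35) \<union> tube R (- 2208/1225, 32/35)"

lemma G_in_tube:
  assumes "\<bar>fst z - x * R\<bar> \<le> 9/50 * R"
  shows "x \<le> 7/10 \<Longrightarrow> \<bar>G (fst z) - 0 * R\<bar> \<le> 3/250 * R"
    and "103/50 \<le> x \<Longrightarrow> \<bar>G (fst z) - (- 24) * R\<bar> \<le> 3/250 * R"
proof -
  (* 7/10 + 9/50 = 22/25 and 103/50 - 9/50 = 47/25 are the ends of the transition region *)
  show "\<bar>G (fst z) - 0 * R\<bar> \<le> 3/250 * R" if "x \<le> 7/10"
  proof -
    have "x * R \<le> 7/10 * R" using that R_ge_1 by (intro mult_right_mono) auto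
    then have "fst z \<le> 22/25 * R" using assms by linarith
    then show ?thesis using G_left by simp
  qed
  show "\<bar>G (fst z) - (- 24) * R\<bar> \<le> 3/250 * R" if "103/50 \<le> x"
  proof -
    have "103/50 * R \<le> x * R" using that R_ge_1 by (intro mult_right_mono) auto
    then have "47/25 * R \<le> fst z" using assms by linarith
    then show ?thesis using G_right by simp
  qed
qed

lemma rest_region_stable:
  assumes "z \<in> rest_region" "\<bar>a\<bar> \<le> R / 30" "\<bar>b\<bar> \<le> R / 30"
  shows "step z (a, b) \<in> rest_region"
proof -
  have z: "z \<in> tube R (0, 0)" using assms(1) by (simp add: rest_region_def)
  have g: "\<bar>G (fst z) - 0 * R\<bar> \<le> 3/250 * R"
    using z by (intro G_in_tube(1)[of z 0]) (auto simp: tube_def)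
  have fst: "\<bar>fst (step z (a, b)) - 0 * R\<bar> \<le> 9/50 * R"
    by (rule step_fst_tube[OF z assms(2) g]) simp
  show ?thesis
    unfolding rest_region_def
    by (rule step_tube[OF z assms(2,3) g _ G_in_tube(1)[OF fst]]) simp_all
qed

lemma cycle_region_stable:
  assumes "z \<in> cycle_region" and a: "\<bar>a\<bar> \<le> R / 30" and b: "\<bar>b\<bar> \<le> R / 30"
  shows "step z (a, b) \<in> cycle_region"
proof -
  consider (1) "z \<in> tube R (2592/1225, 96/455)" | (2) "z \<in> tube R (792/1225, - 48/35)"
    | (3) "z \<in> tube R (- 2208/1225, 32/35)"
    using assms(1) by (auto simp: cycle_region_def)
  then show ?thesis
  proof cases
    case 1
    have g: "\<bar>G (fst z) - (- 24) * R\<bar> \<le> 3/250 * R"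
      using 1 by (intro G_in_tube(2)[of z "2592/1225"]) (auto simp: tube_def)
    have fst: "\<bar>fst (step z (a, b)) - 792/1225 * R\<bar> \<le> 9/50 * R"
      by (rule step_fst_tube[OF 1 a g]) simp
    have "step z (a, b) \<in> tube R (792/1225, - 48/35)"
      by (rule step_tube[OF 1 a b g _ G_in_tube(1)[OF fst]]) simp_all
    then show ?thesis by (simp add: cycle_region_def)
  next
    case 2
    have g: "\<bar>G (fst z) - 0 * R\<bar> \<le> 3/250 * R"
      using 2 by (intro G_in_tube(1)[of z "792/1225"]) (auto simp: tube_def)
    have fst: "\<bar>fst (step z (a, b)) - (- 2208/1225) * R\<bar> \<le> 9/50 * R"
      by (rule step_fst_tube[OF 2 a g]) simp
    have "step z (a, b) \<in> tube R (- 2208/1225, 32/35)"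
      by (rule step_tube[OF 2 a b g _ G_in_tube(1)[OF fst]]) simp_all
    then show ?thesis by (simp add: cycle_region_def)
  next
    case 3
    have g: "\<bar>G (fst z) - 0 * R\<bar> \<le> 3/250 * R"
      using 3 by (intro G_in_tube(1)[of z "- 2208/1225"]) (auto simp: tube_def)
    have fst: "\<bar>fst (step z (a, b)) - 2592/1225 * R\<bar> \<le> 9/50 * R"
      by (rule step_fst_tube[OF 3 a g]) simp
    have "step z (a, b) \<in> tube R (2592/1225, 96/455)"
      by (rule step_tube[OF 3 a b g _ G_in_tube(2)[OF fst]]) simp_all
    then show ?thesis by (simp add: cycle_region_def)
  qed
qed

lemma regions_disjoint: "rest_region \<inter> cycle_region = {}"
proof -
  have "False" if z0: "z \<in> tube R (0, 0)" and z: "z \<in> tube R (x, s)" and x: "1/2 \<le> \<bar>x\<bar>" for z x s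
  proof -
    have "1/2 * R \<le> \<bar>x\<bar> * R" using x R_ge_1 by (intro mult_right_mono) auto
    then have "1/2 * R \<le> \<bar>x * R\<bar>" using R_ge_1 by (simp add: abs_mult)
    moreover have "\<bar>fst z\<bar> \<le> 9/50 * R" "\<bar>fst z - x * R\<bar> \<le> 9/50 * R"
      using z0 z by (simp_all add: tube_def)
    ultimately show False using R_ge_1 by linarith
  qed
  then show ?thesis
    unfolding rest_region_def cycle_region_def by fastforce
qed

lemma origin_in_rest_region: "(0, 0) \<in> rest_region"
  using R_ge_1 by (simp add: rest_region_def tube_def lag_def)

lemma lag_z_cyc: "lag (z_cyc R) = 96/455 * R"
proof -
  have "h_star * sqrt 26 = 2" by (simp add: h_star_def)
  moreover have "lag (z_cyc R) = 240/637 * R * (h_star * sqrt 26) - 10/39 * (2592/1225 * R)"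
    by (simp add: lag_def z_cyc_def)
  ultimately show ?thesis by simp
qed

lemma z_cyc_in_cycle_region: "z_cyc R \<in> cycle_region"
proof -
  have "z_cyc R \<in> tube R (2592/1225, 96/455)"
    using R_ge_1 lag_z_cyc by (simp add: tube_def z_cyc_def)
  then show ?thesis by (simp add: cycle_region_def)
qed

lemma regions_measurable: "rest_region \<in> sets borel" "cycle_region \<in> sets borel"
  unfolding rest_region_def cycle_region_def by simp_all

text \<open>
  The region can be left only if one of the two Gaussian variables exceeds \<open>R/30\<close>.
\<close>
lemma Q_stays:
  assumes A: "A \<in> sets borel" and z: "z \<in> A"
    and stable: "\<And>z a b. z \<in> A \<Longrightarrow> \<bar>a\<bar> \<le> R / 30 \<Longrightarrow> \<bar>b\<bar> \<le> R / 30 \<Longrightarrow> step z (a, b) \<in> A"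
  shows "1 - 2 * (sqrt 2 * exp (- R\<^sup>2 / 3600)) \<le> measure (Q z) A"
proof -
  let ?N = "std_gaussian \<Otimes>\<^sub>M std_gaussian :: (real \<times> real) measure"
  let ?B = "{\<xi> :: real \<times> real. R / 30 < \<bar>fst \<xi>\<bar> \<or> R / 30 < \<bar>snd \<xi>\<bar>}"
  interpret N: prob_space ?N by (rule prob_space_noise)
  have sets_N [measurable_cong]: "sets ?N = sets (borel \<Otimes>\<^sub>M borel)"
    by (intro sets_pair_measure_cong) auto
  have sp: "space ?N = UNIV" using sets_eq_imp_space_eq[OF sets_N] by (simp add: space_pair_measure)
  have B: "?B \<in> sets ?N"
  proof -
    have "{\<xi> \<in> space ?N. R / 30 < \<bar>fst \<xi>\<bar> \<or> R / 30 < \<bar>snd \<xi>\<bar>} \<in> sets ?N" by measurable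
    then show ?thesis by (simp add: sp)
  qed
  have "1 - measure ?N ?B = measure ?N (space ?N - ?B)"
    using N.prob_compl[OF B] by simp
  also have "\<dots> \<le> measure ?N (step z -` A \<inter> space ?N)"
  proof (rule N.finite_measure_mono)
    show "space ?N - ?B \<subseteq> step z -` A \<inter> space ?N"
    proof
      fix \<xi> assume "\<xi> \<in> space ?N - ?B"
      then show "\<xi> \<in> step z -` A \<inter> space ?N"
        using stable[OF z, of "fst \<xi>" "snd \<xi>"] by simp
    qed
    show "step z -` A \<inter> space ?N \<in> sets ?N"
      using A by (intro measurable_sets[OF step_measurable_noise])
  qed
  also have "\<dots> = measure (Q z) A"
    using A unfolding obabo_kernel_def by (subst measure_distr) auto
  finally have "1 - measure ?N ?B \<le> measure (Q z) A" .
  moreover have "measure ?N ?B \<le> 2 * (sqrt 2 * exp (- (R / 30)\<^sup>2 / 4))"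
    using R_ge_1 by (intro noise_tail) simp
  ultimately show ?thesis by (simp add: power_divide)
qed

text \<open>
  For \<open>n > 0\<close> the assumption on \<open>n\<close> forces \<open>E = exp (R\<^sup>2 / 8000) \<ge> 16\<close>. The probability of leaving is at most \<open>4 / E\<^sup>2\<close> per step
  because \<open>1/3600 > 2/8000\<close>, hence at most \<open>1 / (4 E)\<close>, and at most \<open>n / (4 E) \<le> 1/64\<close> during \<open>n\<close> steps.
\<close>
lemma tv_lower_bound:
  assumes A: "A \<in> sets borel" and z: "z \<in> A"
    and stable: "\<And>z a b. z \<in> A \<Longrightarrow> \<bar>a\<bar> \<le> R / 30 \<Longrightarrow> \<bar>b\<bar> \<le> R / 30 \<Longrightarrow> step z (a, b) \<in> A"
    and \<pi>: "prob_space \<pi>" and half: "measure \<pi> A \<le> 1/2"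
    and n: "real n \<le> 1/16 * exp (R\<^sup>2 / 8000)"
  shows "3/8 \<le> tv_dist (law_after Q n (dirac z)) \<pi>"
proof -
  define p where "p = 2 * (sqrt 2 * exp (- R\<^sup>2 / 3600))"
  let ?\<mu> = "law_after Q n (dirac z)"
  note \<mu> = law_after_prob[OF Q_kernel Q_prob, of n z]
  have "7/8 \<le> measure ?\<mu> A"
  proof (cases "n = 0")
    case True
    then show ?thesis using A z by (simp add: law_after_def dirac_def measure_return)
  next
    case False
    define E where "E = exp (R\<^sup>2 / 8000)"
    have E: "16 \<le> E" using n False unfolding E_def by linarith
    have "exp (- R\<^sup>2 / 3600) \<le> exp (- (R\<^sup>2 / 8000) + - (R\<^sup>2 / 8000))" by simp
    also have "\<dots> = 1 / (E * E)" by (simp only: exp_add exp_minus E_def) (simp add: divide_simps)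
    finally have "exp (- R\<^sup>2 / 3600) \<le> 1 / (E * E)" .
    moreover have "sqrt 2 \<le> 2" by (simp add: real_le_lsqrt)
    ultimately have "sqrt 2 * exp (- R\<^sup>2 / 3600) \<le> 2 * (1 / (E * E))"
      by (intro mult_mono) auto
    then have p: "p \<le> 4 / (E * E)" by (simp add: p_def)
    have "4 / (E * E) \<le> 4 / (16 * E)"
      using E by (intro divide_left_mono mult_right_mono) auto
    with p have p': "p \<le> 1 / (4 * E)" by simp
    have p0: "0 \<le> p" by (simp add: p_def)
    have "1 / (4 * E) \<le> 1" using E by simp
    with p' have p1: "p \<le> 1" by linarith
    have "real n * p \<le> E / 16 * (1 / (4 * E))"
      using n p' p0 E by (intro mult_mono) (auto simp: E_def)
    also have "\<dots> \<le> 1/8" using E by simp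
    finally have "real n * p \<le> 1/8" .
    moreover have "1 - real n * p \<le> measure ?\<mu> A"
      by (rule law_after_stays[OF Q_kernel Q_prob A z _ p1])
         (use Q_stays[OF A _ stable] in \<open>simp add: p_def\<close>)
    ultimately show ?thesis by linarith
  qed
  moreover have "measure ?\<mu> A - measure \<pi> A \<le> tv_dist ?\<mu> \<pi>"
    using \<mu> A by (intro tv_dist_ge \<pi>) auto
  ultimately show ?thesis using half by linarith
qed

lemma norm_le_V: "(fst z)\<^sup>2 + (snd z)\<^sup>2 \<le> 3 * V z"
proof -
  have "snd z = 3 / (2 * h_star) * (lag z + 10/39 * fst z)"
    using h_star_pos by (simp add: lag_def)
  then have "(snd z)\<^sup>2 = (3 / (2 * h_star))\<^sup>2 * (lag z + 10/39 * fst z)\<^sup>2"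
    by (simp only: power_mult_distrib)
  also have "(3 / (2 * h_star))\<^sup>2 = 117/8"
  proof -
    have "(3 / (2 * h_star))\<^sup>2 = 9 / (4 * (h_star * h_star))"
      by (simp add: power2_eq_square)
    then show ?thesis unfolding h_star_sq by simp
  qed
  also have "(lag z + 10/39 * fst z)\<^sup>2 \<le> 2 * (lag z)\<^sup>2 + 2 * (10/39 * fst z)\<^sup>2"
    using zero_le_power2[of "lag z - 10/39 * fst z"] by (simp add: power2_eq_square algebra_simps)
  finally have "(snd z)\<^sup>2 \<le> 117/8 * (2 * (lag z)\<^sup>2 + 2 * (10/39 * fst z)\<^sup>2)"
    by simp
  also have "\<dots> \<le> 2 * (fst z)\<^sup>2 + 30 * (lag z)\<^sup>2"
    by (simp add: power_mult_distrib power_divide)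
  finally have "(snd z)\<^sup>2 \<le> 2 * (fst z)\<^sup>2 + 30 * (lag z)\<^sup>2" .
  moreover have "3 * V z = 3 * (fst z)\<^sup>2 + 300 * (lag z)\<^sup>2"
    by (simp add: V_def)
  ultimately show ?thesis
    using zero_le_power2[of "lag z"] zero_le_power2[of "fst z"] by linarith
qed

lemma W2_bound:
  assumes \<pi>: "prob_space \<pi>" "sets \<pi> = sets borel" and V: "(\<integral>\<^sup>+y. V y \<partial>\<pi>) \<le> ennreal (90000 * R\<^sup>2)"
    and z: "(fst z)\<^sup>2 + (snd z)\<^sup>2 \<le> 13 * R\<^sup>2"
  shows "W2 (dirac z) \<pi> \<le> ennreal (740 * R)"
proof (rule W2_dirac_le[OF \<pi>])
  note [measurable_cong] = \<pi>(2)
  have "(dist z y)\<^sup>2 \<le> 26 * R\<^sup>2 + 6 * V y" for y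
  proof -
    have sq: "(u - w)\<^sup>2 \<le> 2 * u\<^sup>2 + 2 * w\<^sup>2" for u w :: real
      using zero_le_power2[of "u + w"] by (simp add: power2_eq_square algebra_simps)
    have "(dist z y)\<^sup>2 = (fst z - fst y)\<^sup>2 + (snd z - snd y)\<^sup>2"
      by (simp add: dist_prod_def dist_real_def)
    also have "\<dots> \<le> 26 * R\<^sup>2 + 6 * V y"
      using sq[of "fst z" "fst y"] sq[of "snd z" "snd y"] z norm_le_V[of y] by linarith
    finally show ?thesis .
  qed
  then have "(\<integral>\<^sup>+y. ennreal ((dist z y)\<^sup>2) \<partial>\<pi>) \<le> (\<integral>\<^sup>+y. ennreal (26 * R\<^sup>2) + 6 * ennreal (V y) \<partial>\<pi>)"
    using V_nonneg by (intro nn_integral_mono) (metis ennreal_leI ennreal_plus ennreal_mult' ennreal_numeral mult_nonneg_nonneg zero_le_numeral zero_le_power2)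
  also have "\<dots> = ennreal (26 * R\<^sup>2) + 6 * (\<integral>\<^sup>+y. V y \<partial>\<pi>)"
    using prob_space.emeasure_space_1[OF \<pi>(1)] by (subst nn_integral_add) (auto simp: nn_integral_cmult)
  also have "\<dots> \<le> ennreal (26 * R\<^sup>2) + 6 * ennreal (90000 * R\<^sup>2)"
    by (intro add_left_mono mult_left_mono V) simp
  also have "\<dots> = ennreal (540026 * R\<^sup>2)"
    by (simp add: ennreal_mult'[symmetric] ennreal_plus[symmetric] flip: ennreal_numeral del: ennreal_plus)
  also have "\<dots> \<le> ennreal ((740 * R)\<^sup>2)"
    by (intro ennreal_leI) (simp add: power_mult_distrib)
  finally show "(\<integral>\<^sup>+y. ennreal ((dist z y)\<^sup>2) \<partial>\<pi>) \<le> ennreal ((740 * R)\<^sup>2)" .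
qed (use R_ge_1 in simp)

text \<open>
  The two regions are disjoint, so the invariant law gives mass at most \<open>1/2\<close> to one of them, and the
  chain is started in that one.
\<close>
theorem slow_mixing:
  "\<exists>\<pi>. invariant_law Q \<pi> \<and> (\<forall>\<pi>'. invariant_law Q \<pi>' \<longrightarrow> \<pi>' = \<pi>) \<and>
    (\<exists>z\<in>{z_cyc R, (0, 0)}. W2 (dirac z) \<pi> \<le> ennreal (740 * R) \<and>
      (\<forall>n. int n \<le> \<lfloor>1 / 16 * exp (R\<^sup>2 / 8000)\<rfloor> \<longrightarrow> 3 / 8 \<le> tv_dist (law_after Q n (dirac z)) \<pi>))"
proof -
  obtain \<pi> where inv: "invariant_law Q \<pi>" and uniq: "\<forall>\<pi>'. invariant_law Q \<pi>' \<longrightarrow> \<pi>' = \<pi>"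
    and V: "(\<integral>\<^sup>+y. V y \<partial>\<pi>) \<le> ennreal (90000 * R\<^sup>2)"
    using invariant_law_second_moment by blast
  have \<pi>: "prob_space \<pi>" "sets \<pi> = sets borel" using inv by (simp_all add: invariant_law_def)
  interpret \<pi>: prob_space \<pi> by (rule \<pi>)
  have n: "real n \<le> 1 / 16 * exp (R\<^sup>2 / 8000)" if "int n \<le> \<lfloor>1 / 16 * exp (R\<^sup>2 / 8000)\<rfloor>" for n
    using that by (simp add: le_floor_iff)
  have "measure \<pi> rest_region + measure \<pi> cycle_region = measure \<pi> (rest_region \<union> cycle_region)"
    using regions_measurable regions_disjoint \<pi>(2) by (intro \<pi>.finite_measure_Union[symmetric]) auto
  also have "\<dots> \<le> 1" by (rule \<pi>.prob_le_1)
  finally consider "measure \<pi> cycle_region \<le> 1/2" | "measure \<pi> rest_region \<le> 1/2" by linarith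
  then have "\<exists>z\<in>{z_cyc R, (0, 0)}. W2 (dirac z) \<pi> \<le> ennreal (740 * R) \<and>
      (\<forall>n. int n \<le> \<lfloor>1 / 16 * exp (R\<^sup>2 / 8000)\<rfloor> \<longrightarrow> 3 / 8 \<le> tv_dist (law_after Q n (dirac z)) \<pi>)"
  proof cases
    case 1
    have "(fst (z_cyc R))\<^sup>2 + (snd (z_cyc R))\<^sup>2 \<le> 13 * R\<^sup>2"
    proof -
      have "(fst (z_cyc R))\<^sup>2 + (snd (z_cyc R))\<^sup>2 = ((2592/1225)\<^sup>2 + (360/637)\<^sup>2 * 26) * R\<^sup>2"
        by (simp add: z_cyc_def power_mult_distrib power_divide algebra_simps)
      also have "\<dots> \<le> 13 * R\<^sup>2"
        by (intro mult_right_mono) (simp_all add: power_divide)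
      finally show ?thesis .
    qed
    then show ?thesis
      using W2_bound[OF \<pi> V] n
        tv_lower_bound[OF regions_measurable(2) z_cyc_in_cycle_region cycle_region_stable \<pi>(1) 1]
      by blast
  next
    case 2
    have "(fst (0, 0))\<^sup>2 + (snd (0, 0))\<^sup>2 \<le> 13 * R\<^sup>2" by simp
    then show ?thesis
      using W2_bound[OF \<pi> V] n
        tv_lower_bound[OF regions_measurable(1) origin_in_rest_region rest_region_stable \<pi>(1) 2]
      by blast
  qed
  then show ?thesis using inv uniq by blast
qed

end

section \<open>Slow mixing\<close>

theorem corollary1p5:
  shows "\<exists>(U :: real \<Rightarrow> real) (C :: real).
    smooth U \<and> (\<forall>x. 1 \<le> deriv (deriv U) x \<and> deriv (deriv U) x \<le> 25) \<and> C > 0 \<and>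
    (\<forall>R :: real. R \<ge> 1 \<longrightarrow>
      (let U\<^sub>R = scaled_potential R U;
           Q\<^sub>R = obabo_kernel h_star gamma_star U\<^sub>R
       in U\<^sub>R \<in> potential_class 25 \<and>
          (\<exists>\<pi>\<^sub>R. invariant_law Q\<^sub>R \<pi>\<^sub>R \<and> (\<forall>\<pi>. invariant_law Q\<^sub>R \<pi> \<longrightarrow> \<pi> = \<pi>\<^sub>R) \<and>
            (\<exists>z\<^sub>R \<in> {z_cyc R, (0, 0)}.
               W2 (dirac z\<^sub>R) \<pi>\<^sub>R \<le> ennreal (C * R) \<and>
               (\<forall>n :: nat. int n \<le> \<lfloor>1 / 16 * exp (R\<^sup>2 / 8000)\<rfloor> \<longrightarrow>
                  tv_dist (law_after Q\<^sub>R n (dirac z\<^sub>R)) \<pi>\<^sub>R \<ge> 3 / 8)))))"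
proof -
  obtain U F :: "real \<Rightarrow> real" where dU: "\<And>x. (U has_real_derivative F x) (at x)"
    and smooth: "smooth U"
    and lb: "\<And>x. 1 \<le> deriv (deriv U) x" and ub: "\<And>x. deriv (deriv U) x \<le> 25"
    and F: "\<And>x. \<bar>F x - 25 * x\<bar> \<le> 25"
      "\<And>x. x \<le> 22/25 \<Longrightarrow> \<bar>F x - 25 * x\<bar> \<le> 3/250"
      "\<And>x. x \<ge> 47/25 \<Longrightarrow> \<bar>F x - (25 * x - 24)\<bar> \<le> 3/250"
    by (rule potential_exists, rule that)
  have F_cont: "continuous_on UNIV F"
  proof -
    have "F = deriv U" using dU by (auto intro!: DERIV_imp_deriv[symmetric])
    moreover have "isCont (deriv U) x" for x
      using DERIV_isCont[OF smooth_differentiable[OF smooth, of 1]] by simp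
    ultimately show ?thesis by (simp add: continuous_on_eq_continuous_at)
  qed
  have main: "scaled_potential R U \<in> potential_class 25 \<and>
      (\<exists>\<pi>. invariant_law (obabo_kernel h_star gamma_star (scaled_potential R U)) \<pi> \<and>
        (\<forall>\<pi>'. invariant_law (obabo_kernel h_star gamma_star (scaled_potential R U)) \<pi>' \<longrightarrow> \<pi>' = \<pi>) \<and>
        (\<exists>z\<in>{z_cyc R, (0, 0)}. W2 (dirac z) \<pi> \<le> ennreal (740 * R) \<and>
          (\<forall>n. int n \<le> \<lfloor>1 / 16 * exp (R\<^sup>2 / 8000)\<rfloor> \<longrightarrow>
            3 / 8 \<le> tv_dist (law_after (obabo_kernel h_star gamma_star (scaled_potential R U)) n (dirac z)) \<pi>)))"
    if R: "1 \<le> R" for R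
  proof -
    define G where "G x = R * (F (x / R) - 25 * (x / R))" for x
    have R0: "0 < R" using R by simp
    have "continuous_on UNIV (\<lambda>x. F (x / R))"
      by (rule continuous_on_compose2[OF F_cont]) (use R0 in \<open>auto intro!: continuous_intros\<close>)
    then have [measurable]: "(\<lambda>x. F (x / R)) \<in> borel_measurable borel"
      by (rule borel_measurable_continuous_onI)
    have mult_abs: "\<bar>R * t\<bar> \<le> c * R" if "\<bar>t\<bar> \<le> c" for t c
      using mult_right_mono[OF that, of R] R0 by (simp add: abs_mult mult.commute)
    interpret scaled_force "scaled_potential R U" "\<lambda>x. R * F (x / R)" G R
    proof
      show "(scaled_potential R U has_real_derivative R * F (x / R)) (at x)" for x
        using R0 by (intro scaled_potential_deriv dU) simp
      show "R * F (x / R) = 25 * x + G x" for x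
        using R0 by (simp add: G_def algebra_simps)
      show "G \<in> borel_measurable borel" unfolding G_def by measurable
      show "\<bar>G x\<bar> \<le> 25 * R" for x
        unfolding G_def by (rule mult_abs[OF F(1)])
      show "\<bar>G x\<bar> \<le> 3/250 * R" if "x \<le> 22/25 * R" for x
        unfolding G_def using that R0 by (intro mult_abs F(2)) (simp add: field_simps)
      show "\<bar>G x + 24 * R\<bar> \<le> 3/250 * R" if "47/25 * R \<le> x" for x
      proof -
        have "\<bar>R * (F (x / R) - (25 * (x / R) - 24))\<bar> \<le> 3/250 * R"
          using that R0 by (intro mult_abs F(3)) (simp add: field_simps)
        then show ?thesis by (simp add: G_def algebra_simps)
      qed
    qed (rule R)
    have "scaled_potential R U \<in> potential_class 25"
      using R0 smooth lb ub
      by (simp add: potential_class_def smooth_scaled_potential scaled_potential_deriv2)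
    then show ?thesis using slow_mixing by blast
  qed
  show ?thesis
    by (rule exI[of _ U], rule exI[of _ 740]) (use smooth lb ub main in \<open>simp add: Let_def\<close>)
qed

end
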